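(* Let $G$ be a connected unicyclic graph of order $n \geq 6$. Then there exists $\alpha_0 \in (\frac{1}{2}, 1)$ such that for any $0 \le \alpha < \alpha_0$, $$\rho_{D_\alpha}(G) \ge \rho_{D_\alpha}(S_n^+),$$ where $\rho_{D_\alpha}(S_n^+)$ is the largest root of the following equation in $\rho$: $$\rho^3 - (3\alpha n + 2n - \alpha - 7)\rho^2 + (2\alpha^2 n^2 + 6\alpha n^2 - \alpha^2 n - 17\alpha n + 2\alpha - 7n + 17)\rho - (4\alpha^2 n^3 - 10\alpha^2 n^2 - 8\alpha n^2 + 4\alpha^2 n + 19\alpha n - 7\alpha + 3n - 5) = 0.$$ Furthermore, equality holds if and only if $G \cong S_n^+$.
   Context: For a connected graph $G$ with vertex set $V(G)$, $d_{uv}$ denotes the distance between vertices $u,v$, and the transmission of $u$ is $Tr(u)=\sum_{v\in V(G)} d_{uv}$. $D(G)=(d_{uv})$ is the distance matrix, $Tr(G)$ is the diagonal matrix of vertex transmissions, and the generalized distance matrix is $D_\alpha(G) = \alpha\, Tr(G) + (1-\alpha) D(G)$ for $0 \le \alpha \le 1$. $\rho_{D_\alpha}(G)$ denotes the spectral radius (largest eigenvalue) of $D_\alpha(G)$. A unicyclic graph is a connected graph with exactly one cycle. $S_n^+$ denotes the $n$-vertex unicyclic graph obtained from the star $S_n$ on $n$ vertices by adding one edge (joining two leaves). *)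

theory Defs
  imports
    "Graph_Theory.Graph_Theory"
    "Jordan_Normal_Form.Spectral_Radius"
begin

text \<open>
  A finite simple graph is a \<^locale>\<open>pair_graph\<close>: a finite loop-free symmetric digraph without
  parallel arcs, in which an undirected edge \<open>uv\<close> is the pair of arcs \<open>(u,v)\<close>, \<open>(v,u)\<close>.
\<close>

text \<open>
  In a symmetric digraph \<^const>\<open>pre_digraph.cycle\<close> also holds of the walks \<open>u, v, u\<close>, hence the
  length bound. A cycle of the undirected graph is identified with its set of undirected edges,
  so that the rotations and the reversal of a closed walk count as the same cycle.
\<close>

definition undirected_cycles :: "'a pair_pre_digraph \<Rightarrow> 'a set set set" where
  "undirected_cycles G =
     {(\<lambda>(u, v). {u, v}) ` set p | p. pre_digraph.cycle (with_proj G) p \<and> 3 \<le> length p}"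

definition unicyclic :: "'a pair_pre_digraph \<Rightarrow> bool" where
  "unicyclic G \<longleftrightarrow>
     pair_graph G \<and> Digraph_Component.connected (with_proj G) \<and>
     (\<exists>!C. C \<in> undirected_cycles G)"

definition gdist :: "'a pair_pre_digraph \<Rightarrow> 'a \<Rightarrow> 'a \<Rightarrow> real" where
  "gdist G u v = real_of_ereal (wf_digraph.\<mu> (with_proj G) (\<lambda>_. 1) u v)"

definition transmission :: "'a pair_pre_digraph \<Rightarrow> 'a \<Rightarrow> real" where
  "transmission G u = (\<Sum>v\<in>pverts G. gdist G u v)"

text \<open>
  The matrices are indexed by \<open>{0..<n}\<close>, \<open>n\<close> the number of vertices. For a finite vertex set,
  \<^term>\<open>from_nat_into (pverts G)\<close> maps this index set bijectively to the vertices; another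
  enumeration would give a matrix similar by a permutation, with the same spectrum.
\<close>

definition distance_mat :: "'a pair_pre_digraph \<Rightarrow> real mat" where
  "distance_mat G =
     (let n = card (pverts G); v = from_nat_into (pverts G)
      in mat n n (\<lambda>(i, j). gdist G (v i) (v j)))"

definition transmission_mat :: "'a pair_pre_digraph \<Rightarrow> real mat" where
  "transmission_mat G =
     (let n = card (pverts G); v = from_nat_into (pverts G)
      in mat n n (\<lambda>(i, j). if i = j then transmission G (v i) else 0))"

definition gen_distance_mat :: "real \<Rightarrow> 'a pair_pre_digraph \<Rightarrow> real mat" where
  "gen_distance_mat \<alpha> G =
     \<alpha> \<cdot>\<^sub>m transmission_mat G + (1 - \<alpha>) \<cdot>\<^sub>m distance_mat G"

text \<open>
  \<^const>\<open>spectral_radius\<close> is the largest modulus of a complex eigenvalue. As the matrix is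
  symmetric and, for \<open>0 \<le> \<alpha> \<le> 1\<close>, nonnegative, this is its largest eigenvalue.
\<close>

definition rho_D :: "real \<Rightarrow> 'a pair_pre_digraph \<Rightarrow> real" where
  "rho_D \<alpha> G = spectral_radius (map_mat complex_of_real (gen_distance_mat \<alpha> G))"

text \<open>The star on \<open>{0..<n}\<close> has centre \<open>0\<close>; the added edge joins the leaves \<open>1\<close> and \<open>2\<close>.\<close>

definition star_graph :: "nat \<Rightarrow> nat pair_pre_digraph" where
  "star_graph n =
     \<lparr>pverts = {0..<n}, parcs = {(0, i) | i. i \<in> {1..<n}} \<union> {(i, 0) | i. i \<in> {1..<n}}\<rparr>"

definition star_plus :: "nat \<Rightarrow> nat pair_pre_digraph" where
  "star_plus n =
     \<lparr>pverts = pverts (star_graph n), parcs = parcs (star_graph n) \<union> {(1, 2), (2, 1)}\<rparr>"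

definition star_plus_cubic :: "real \<Rightarrow> real \<Rightarrow> real \<Rightarrow> real" where
  "star_plus_cubic \<alpha> n \<rho> =
     \<rho>^3
     - (3 * \<alpha> * n + 2 * n - \<alpha> - 7) * \<rho>^2
     + (2 * \<alpha>^2 * n^2 + 6 * \<alpha> * n^2 - \<alpha>^2 * n - 17 * \<alpha> * n + 2 * \<alpha> - 7 * n + 17) * \<rho>
     - (4 * \<alpha>^2 * n^3 - 10 * \<alpha>^2 * n^2 - 8 * \<alpha> * n^2 + 4 * \<alpha>^2 * n
        + 19 * \<alpha> * n - 7 * \<alpha> + 3 * n - 5)"

definition is_largest_root :: "(real \<Rightarrow> real) \<Rightarrow> real \<Rightarrow> bool" where
  "is_largest_root f x \<longleftrightarrow> f x = 0 \<and> (\<forall>y. f y = 0 \<longrightarrow> y \<le> x)"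

end

(*
  The all-ones vector gives rho(G) >= 2 W(G) / n, where W is the Wiener index: by Cauchy-Schwarz
  the entry sums of D^(2^k) grow at least like (2 W(G) / n)^(2^k).  Counting the pairs at distance
  at most two through the degrees shows that a unicyclic graph other than S_n^+ has
  2 W(G) >= 2 n^2 - 2 n - 8.  For S_n^+ the eigenvectors that are constant on the centre, the two
  triangle vertices and the leaves reduce D_alpha to a 3x3 matrix whose characteristic polynomial is
  the cubic; every root that is at least 2 n - 4 has a positive eigenvector and hence equals the
  spectral radius, and by the intermediate value theorem such a root lies below
  2 n - 2 - 8/n when alpha < 3/4.
*)

theory Submission
  imports Defs "HOL-Analysis.Convex"
begin

section \<open>Spectral radius\<close>

text \<open>The lower bound for a competitor does not involve \<alpha>, since every row of
  D_\<alpha> sums to the transmission of its vertex. The entry sum for S_n^+ is 2 n^2 - 4 n, so a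
  competitor gains at least 2 n - 8; the value 2 n^2 - 2 n - 8 is attained, for instance by a
  4-cycle with all further vertices pendant at one of its vertices. As \<alpha> tends to 1,
  D_\<alpha> tends to the diagonal matrix of transmissions, and the radius of S_n^+ tends to the
  largest transmission 2 n - 3. The average 2 n - 2 - 8/n reaches 2 n - 3 exactly when n >= 8. For n
  = 6 and n = 7 it stays below, so comparing with the average must break down near \<alpha> = 1; 3/4
  is a convenient value in (1/2, 1) that keeps clear of the breakdown. The comparison is strict for
  every competitor, and this settles the equality case as well.\<close>

lemma spectral_radius_positive_eigenvector:
  fixes A :: "real mat"
  assumes A: "A \<in> carrier_mat n n" and n: "0 < n"
    and nonneg: "\<And>i j. i < n \<Longrightarrow> j < n \<Longrightarrow> 0 \<le> A $$ (i, j)"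
    and pos: "\<And>i. i < n \<Longrightarrow> 0 < f i"
    and eig: "\<And>i. i < n \<Longrightarrow> (\<Sum>j<n. A $$ (i, j) * f j) = r * f i"
  shows "spectral_radius (map_mat complex_of_real A) = r"
proof -
  let ?B = "map_mat complex_of_real A"
  have B: "?B \<in> carrier_mat n n" using A by simp
  have "eigenvector ?B (vec n (\<lambda>i. complex_of_real (f i))) (complex_of_real r)"
    unfolding eigenvector_def
  proof (intro conjI)
    show "vec n (\<lambda>i. complex_of_real (f i)) \<in> carrier_vec (dim_row ?B)" using A by simp
    have "vec n (\<lambda>i. complex_of_real (f i)) $ 0 \<noteq> 0\<^sub>v (dim_row ?B) $ 0"
      using A n pos[OF n] by simp
    then show "vec n (\<lambda>i. complex_of_real (f i)) \<noteq> 0\<^sub>v (dim_row ?B)" by metis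
    show "?B *\<^sub>v vec n (\<lambda>i. complex_of_real (f i))
        = complex_of_real r \<cdot>\<^sub>v vec n (\<lambda>i. complex_of_real (f i))"
    proof (rule eq_vecI)
      fix i assume "i < dim_vec (complex_of_real r \<cdot>\<^sub>v vec n (\<lambda>i. complex_of_real (f i)))"
      then have i: "i < n" by simp
      have "(?B *\<^sub>v vec n (\<lambda>i. complex_of_real (f i))) $ i
          = (\<Sum>j<n. complex_of_real (A $$ (i, j)) * complex_of_real (f j))"
        using A i by (simp add: scalar_prod_def atLeast0LessThan)
      also have "\<dots> = complex_of_real (\<Sum>j<n. A $$ (i, j) * f j)" by simp
      finally show "(?B *\<^sub>v vec n (\<lambda>i. complex_of_real (f i))) $ i
          = (complex_of_real r \<cdot>\<^sub>v vec n (\<lambda>i. complex_of_real (f i))) $ i"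
        using eig[OF i] i by simp
    qed (use A in simp)
  qed
  then have "complex_of_real r \<in> spectrum ?B"
    by (auto simp: spectrum_def eigenvalue_def)
  then have "norm (complex_of_real r) \<le> spectral_radius ?B"
    by (intro spectral_radius_mem_max(2)[OF B n]) blast
  then have lower: "r \<le> spectral_radius ?B" by simp
  obtain k where k: "eigenvalue ?B k" and rho: "spectral_radius ?B = norm k"
    using spectral_radius_mem_max(1)[OF B n] by (auto simp: spectrum_def)
  from k obtain v where v: "eigenvector ?B v k" by (auto simp: eigenvalue_def)
  have dimv: "dim_vec v = n" and vnz: "v \<noteq> 0\<^sub>v n" and Bv: "?B *\<^sub>v v = k \<cdot>\<^sub>v v"
    using v A by (auto simp: eigenvector_def)
  \<comment> \<open>This is the Perron-Frobenius bound without irreducibility: in the row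
    \<open>m\<close> where |v i| / f i is largest, the triangle inequality and the equation for the
    positive vector \<open>f\<close> bound the modulus of the arbitrary eigenvalue \<open>k\<close>
    by \<open>r\<close>.\<close>
  define g where "g i = norm (v $ i) / f i" for i
  obtain m where m: "m < n" and gmax: "\<And>i. i < n \<Longrightarrow> g i \<le> g m"
  proof -
    have "finite (g ` {..<n})" "g ` {..<n} \<noteq> {}" using n by auto
    from Max_in[OF this] obtain m where "m < n" "g m = Max (g ` {..<n})" by auto
    then show thesis by (intro that[of m]) auto
  qed
  have bound: "norm (v $ i) \<le> g m * f i" if "i < n" for i
    using gmax[OF that] pos[OF that] by (simp add: g_def field_simps)
  obtain l where l: "l < n" "v $ l \<noteq> 0"
  proof (rule ccontr)
    assume "\<not> thesis"
    then have "v = 0\<^sub>v n" using that dimv by (intro eq_vecI) auto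
    then show False using vnz by simp
  qed
  have "0 < g l" using l pos[OF l(1)] by (simp add: g_def)
  then have gm: "0 < g m" using gmax[OF l(1)] by linarith
  have vm: "norm (v $ m) = g m * f m" using pos[OF m] by (simp add: g_def)
  have "k * v $ m = (\<Sum>j<n. complex_of_real (A $$ (m, j)) * v $ j)"
    using arg_cong[OF Bv, of "\<lambda>w. w $ m"] A m dimv
    by (simp add: scalar_prod_def atLeast0LessThan)
  then have "norm k * norm (v $ m) \<le> (\<Sum>j<n. norm (complex_of_real (A $$ (m, j)) * v $ j))"
    by (metis norm_mult norm_sum)
  also have "\<dots> \<le> (\<Sum>j<n. A $$ (m, j) * (g m * f j))"
    using nonneg[OF m] bound by (intro sum_mono) (auto simp: norm_mult intro!: mult_left_mono)
  also have "\<dots> = g m * (\<Sum>j<n. A $$ (m, j) * f j)"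
    by (simp add: sum_distrib_left mult_ac)
  also have "\<dots> = r * norm (v $ m)" using eig[OF m] vm by simp
  finally have "norm k \<le> r" using vm gm pos[OF m] by simp
  then show ?thesis using lower rho by simp
qed

section \<open>Lower bound through the quadratic form of the all-ones vector\<close>

definition entry_sum :: "real mat \<Rightarrow> real" where
  "entry_sum A = (\<Sum>i<dim_row A. \<Sum>j<dim_col A. A $$ (i, j))"

lemma entry_sum_carrier:
  "A \<in> carrier_mat n n \<Longrightarrow> entry_sum A = (\<Sum>i<n. \<Sum>j<n. A $$ (i, j))"
  by (simp add: entry_sum_def)

lemma pow_mat_add:
  fixes A :: "'a::semiring_1 mat"
  assumes A: "A \<in> carrier_mat n n"
  shows "A ^\<^sub>m (k + l) = A ^\<^sub>m k * A ^\<^sub>m l"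
proof (induction l)
  case 0 then show ?case using right_mult_one_mat[OF pow_carrier_mat[OF A, of k]] A by simp
next
  case (Suc l)
  then show ?case
    using assoc_mult_mat[OF pow_carrier_mat[OF A, of k] pow_carrier_mat[OF A, of l] A] by simp
qed

lemma pow_mat_symmetric:
  fixes A :: "'a::comm_semiring_1 mat"
  assumes A: "A \<in> carrier_mat n n" and sym: "A\<^sup>T = A"
  shows "(A ^\<^sub>m k)\<^sup>T = A ^\<^sub>m k"
proof (induction k)
  case 0 then show ?case by simp
next
  case (Suc k)
  have "(A ^\<^sub>m Suc k)\<^sup>T = A * A ^\<^sub>m k"
    using transpose_mult[OF pow_carrier_mat[OF A, of k] A] Suc sym by simp
  also have "\<dots> = A ^\<^sub>m Suc k"
    using pow_mat_add[OF A, of 1 k] A by simp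
  finally show ?case .
qed

text \<open>Cauchy--Schwarz for the row sums of \<open>B = A ^ k\<close>, whose squares add up to the entry sum of \<open>B\<^sup>T B\<close>.\<close>

lemma entry_sum_pow_double:
  assumes A: "A \<in> carrier_mat n n" and sym: "A\<^sup>T = A"
  shows "(entry_sum (A ^\<^sub>m k))\<^sup>2 \<le> real n * entry_sum (A ^\<^sub>m (k + k))"
proof -
  let ?B = "A ^\<^sub>m k"
  have B: "?B \<in> carrier_mat n n" using A by simp
  have symB: "?B $$ (i, j) = ?B $$ (j, i)" if "i < n" "j < n" for i j
    using arg_cong[OF pow_mat_symmetric[OF A sym, of k], of "\<lambda>M. M $$ (j, i)"] that A by simp
  define s where "s l = (\<Sum>j<n. ?B $$ (l, j))" for l
  have "entry_sum (A ^\<^sub>m (k + k)) = (\<Sum>i<n. \<Sum>j<n. \<Sum>l<n. ?B $$ (i, l) * ?B $$ (l, j))"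
    using B A unfolding pow_mat_add[OF A] entry_sum_carrier[OF mult_carrier_mat[OF B B]]
    by (simp add: scalar_prod_def atLeast0LessThan)
  also have "\<dots> = (\<Sum>i<n. \<Sum>l<n. ?B $$ (i, l) * s l)"
    by (subst sum.swap) (simp add: s_def sum_distrib_left)
  also have "\<dots> = (\<Sum>l<n. \<Sum>i<n. ?B $$ (l, i) * s l)"
    by (subst sum.swap) (intro sum.cong refl, simp add: symB)
  also have "\<dots> = (\<Sum>l<n. (s l)\<^sup>2)"
    by (simp add: s_def power2_eq_square sum_distrib_right)
  finally have dbl: "entry_sum (A ^\<^sub>m (k + k)) = (\<Sum>l<n. (s l)\<^sup>2)" .
  have "entry_sum ?B = (\<Sum>l<n. s l)"
    by (simp add: entry_sum_carrier[OF B] s_def)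
  then show ?thesis
    using sum_squared_le_sum_of_squares[of s "{..<n}"] dbl by (simp add: mult.commute)
qed

text \<open>With q the average row sum, the bound n q^(2^k) reproduces itself: squaring it and
  dividing by n, as the doubling inequality permits, gives n q^(2^(k+1)). Nonnegativity of the entry
  sum makes the squaring monotone.\<close>

lemma entry_sum_pow_exp:
  assumes A: "A \<in> carrier_mat n n" and sym: "A\<^sup>T = A" and n: "0 < n"
    and pos: "0 \<le> entry_sum A"
  shows "real n * (entry_sum A / real n) ^ 2 ^ k \<le> entry_sum (A ^\<^sub>m 2 ^ k)"
proof (induction k)
  case 0 then show ?case using A n by simp
next
  case (Suc k)
  let ?q = "entry_sum A / real n"
  have "(real n * ?q ^ 2 ^ k)\<^sup>2 \<le> (entry_sum (A ^\<^sub>m 2 ^ k))\<^sup>2"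
    using Suc pos n by (intro power_mono) auto
  also have "\<dots> \<le> real n * entry_sum (A ^\<^sub>m 2 ^ Suc k)"
    using entry_sum_pow_double[OF A sym, of "2 ^ k"] by (simp add: mult_2)
  finally have "real n * (real n * ?q ^ 2 ^ Suc k) \<le> real n * entry_sum (A ^\<^sub>m 2 ^ Suc k)"
    by (simp add: power_mult_distrib power2_eq_square mult_2 power_add mult_ac)
  then show ?case using n by simp
qed

text \<open>A radius below 1 would keep all powers bounded entrywise, by the Jordan normal form,
  whereas an average row sum above 1 makes the entry sums of the powers with exponent 2^k unbounded.
  Normalising to 1 is what lets mere boundedness take the place of a growth rate.\<close>

lemma spectral_radius_ge_1:
  assumes A: "A \<in> carrier_mat n n" and sym: "A\<^sup>T = A" and n: "0 < n"
    and big: "real n < entry_sum A"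
  shows "1 \<le> spectral_radius (map_mat complex_of_real A)"
proof (rule ccontr)
  let ?B = "map_mat complex_of_real A"
  assume "\<not> ?thesis"
  then have "spectral_radius ?B < 1" by simp
  then obtain c where c: "\<And>k. norm_bound (?B ^\<^sub>m k) c"
    using spectral_radius_jnf_norm_bound_less_1_upper_triangular[of ?B n] A by auto
  have entry: "(A ^\<^sub>m k) $$ (i, j) \<le> c" if "i < n" "j < n" for i j k
  proof -
    have "?B ^\<^sub>m k = map_mat complex_of_real (A ^\<^sub>m k)"
      by (rule of_real_hom.mat_hom_pow[OF A, symmetric])
    then have "norm (complex_of_real ((A ^\<^sub>m k) $$ (i, j))) \<le> c"
      using c[of k] that A unfolding norm_bound_def by simp
    then show ?thesis by simp
  qed
  have bounded: "entry_sum (A ^\<^sub>m k) \<le> real n * (real n * c)" for k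
  proof -
    have "entry_sum (A ^\<^sub>m k) \<le> (\<Sum>i<n. \<Sum>j<n. c)"
      unfolding entry_sum_carrier[OF pow_carrier_mat[OF A]] by (intro sum_mono entry) auto
    then show ?thesis by simp
  qed
  let ?q = "entry_sum A / real n"
  have q: "1 < ?q" using big n by simp
  then obtain k where k: "real n * c < ?q ^ k" using real_arch_pow by blast
  have "?q ^ k \<le> ?q ^ 2 ^ k" using q by (intro power_increasing) auto
  moreover have "real n * ?q ^ 2 ^ k \<le> real n * (real n * c)"
    using entry_sum_pow_exp[OF A sym n, of k] bounded[of "2 ^ k"] big by linarith
  ultimately show False using k n by simp
qed

text \<open>Scaling: for t strictly between the radius and the average, A / t has average row sum
  above 1, hence an eigenvalue of modulus at least 1, and t times it would be an eigenvalue of A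
  beyond the radius.\<close>

lemma spectral_radius_ge_average:
  assumes A: "A \<in> carrier_mat n n" and sym: "A\<^sup>T = A" and n: "0 < n"
  shows "entry_sum A / real n \<le> spectral_radius (map_mat complex_of_real A)"
proof (rule ccontr)
  let ?B = "map_mat complex_of_real A" let ?q = "entry_sum A / real n"
  assume "\<not> ?thesis"
  then obtain t where t: "spectral_radius ?B < t" "t < ?q" using dense by (auto simp: not_le)
  have B: "?B \<in> carrier_mat n n" using A by simp
  have "0 \<le> spectral_radius ?B" using spectral_radius_mem_max(1)[OF B n] by auto
  then have t0: "0 < t" using t by linarith
  define R where "R = (1 / t) \<cdot>\<^sub>m A"
  have R: "R \<in> carrier_mat n n" using A by (simp add: R_def)
  have symR: "R\<^sup>T = R"
  proof (rule eq_matI)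
    fix i j assume "i < dim_row R" "j < dim_col R"
    then show "R\<^sup>T $$ (i, j) = R $$ (i, j)"
      using A arg_cong[OF sym, of "\<lambda>M. M $$ (i, j)"] by (simp add: R_def)
  qed (use R in auto)
  have sumR: "entry_sum R = entry_sum A / t"
    using A by (simp add: entry_sum_def R_def sum_divide_distrib)
  have "real n < entry_sum R" using t(2) t0 n by (simp add: sumR field_simps)
  from spectral_radius_ge_1[OF R symR n this]
  have "1 \<le> spectral_radius (map_mat complex_of_real R)" .
  moreover have RC: "map_mat complex_of_real R \<in> carrier_mat n n" using R by simp
  ultimately obtain k v where k: "1 \<le> norm k" and v: "eigenvector (map_mat complex_of_real R) v k"
    using spectral_radius_mem_max(1)[OF RC n] by (auto simp: spectrum_def eigenvalue_def)
  have "map_mat complex_of_real R *\<^sub>v v = complex_of_real (1 / t) \<cdot>\<^sub>v (?B *\<^sub>v v)"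
    using A v[unfolded eigenvector_def, THEN conjunct1]
    by (intro eq_vecI) (auto simp: R_def scalar_prod_def sum_divide_distrib)
  then have eq: "complex_of_real (1 / t) \<cdot>\<^sub>v (?B *\<^sub>v v) = k \<cdot>\<^sub>v v"
    using v by (simp add: eigenvector_def)
  have "?B *\<^sub>v v = (complex_of_real t * k) \<cdot>\<^sub>v v"
  proof (rule eq_vecI)
    fix i assume "i < dim_vec ((complex_of_real t * k) \<cdot>\<^sub>v v)"
    then have i: "i < n" "dim_vec v = n" using v R by (auto simp: eigenvector_def)
    then show "(?B *\<^sub>v v) $ i = ((complex_of_real t * k) \<cdot>\<^sub>v v) $ i"
      using arg_cong[OF eq, of "\<lambda>w. w $ i"] A t0 by (simp add: field_simps)
  qed (use v R A in \<open>auto simp: eigenvector_def\<close>)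
  then have "complex_of_real t * k \<in> spectrum ?B"
    using v R A by (auto simp: spectrum_def eigenvalue_def eigenvector_def)
  then have "norm (complex_of_real t * k) \<le> spectral_radius ?B"
    by (intro spectral_radius_mem_max(2)[OF B n]) blast
  moreover have "norm (complex_of_real t * k) = t * norm k" using t0 by (simp add: norm_mult)
  moreover have "t * 1 \<le> t * norm k" using k t0 by (intro mult_left_mono) auto
  ultimately show False using t(1) by linarith
qed

section \<open>The generalized distance matrix of \<open>S\<^sub>n\<^sup>+\<close>\<close>

lemma gen_distance_mat_carrier:
  "gen_distance_mat \<alpha> G \<in> carrier_mat (card (pverts G)) (card (pverts G))"
  by (simp add: gen_distance_mat_def transmission_mat_def distance_mat_def Let_def)

lemma gen_distance_mat_index:
  assumes "i < card (pverts G)" "j < card (pverts G)"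
  shows "gen_distance_mat \<alpha> G $$ (i, j)
    = (if i = j then \<alpha> * transmission G (from_nat_into (pverts G) i) else 0)
      + (1 - \<alpha>) * gdist G (from_nat_into (pverts G) i) (from_nat_into (pverts G) j)"
  using assms by (simp add: gen_distance_mat_def transmission_mat_def distance_mat_def Let_def)

lemma sum_pverts_enum:
  assumes "finite (pverts G)"
  shows "(\<Sum>i<card (pverts G). h (from_nat_into (pverts G) i)) = (\<Sum>v\<in>pverts G. h v)"
  using sum.reindex_bij_betw[OF bij_betw_from_nat_into_finite[OF assms], of h] by simp

lemma rho_D_positive_eigenvector:
  assumes fin: "finite (pverts G)" and ne: "pverts G \<noteq> {}"
    and \<alpha>: "0 \<le> \<alpha>" "\<alpha> \<le> 1"
    and dist: "\<And>u v. u \<in> pverts G \<Longrightarrow> v \<in> pverts G \<Longrightarrow> 0 \<le> gdist G u v"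
    and pos: "\<And>u. u \<in> pverts G \<Longrightarrow> 0 < f u"
    and eig: "\<And>u. u \<in> pverts G \<Longrightarrow>
      \<alpha> * transmission G u * f u + (1 - \<alpha>) * (\<Sum>v\<in>pverts G. gdist G u v * f v) = r * f u"
  shows "rho_D \<alpha> G = r"
  unfolding rho_D_def
proof (rule spectral_radius_positive_eigenvector[OF gen_distance_mat_carrier])
  let ?e = "from_nat_into (pverts G)" let ?n = "card (pverts G)"
  have e: "?e i \<in> pverts G" for i using ne by (rule from_nat_into)
  have tr: "0 \<le> transmission G (?e i)" for i
    unfolding transmission_def by (intro sum_nonneg dist e)
  show "0 < ?n" using fin ne by (simp add: card_gt_0_iff)
  show "0 \<le> gen_distance_mat \<alpha> G $$ (i, j)" if "i < ?n" "j < ?n" for i j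
    using that \<alpha> tr dist[OF e e] by (simp add: gen_distance_mat_index)
  show "0 < f (?e i)" for i by (rule pos[OF e])
  fix i assume i: "i < ?n"
  have "(\<Sum>j<?n. gen_distance_mat \<alpha> G $$ (i, j) * f (?e j))
      = (\<Sum>j<?n. (if i = j then \<alpha> * transmission G (?e i) * f (?e i) else 0)
          + (1 - \<alpha>) * (gdist G (?e i) (?e j) * f (?e j)))"
    using i by (intro sum.cong) (auto simp: gen_distance_mat_index algebra_simps)
  also have "\<dots> = \<alpha> * transmission G (?e i) * f (?e i)
      + (1 - \<alpha>) * (\<Sum>j<?n. gdist G (?e i) (?e j) * f (?e j))"
    using i by (simp add: sum.distrib sum_distrib_left)
  also have "\<dots> = r * f (?e i)"
    using eig[OF e, of i] sum_pverts_enum[OF fin, of "\<lambda>v. gdist G (?e i) v * f v"] by simp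
  finally show "(\<Sum>j<?n. gen_distance_mat \<alpha> G $$ (i, j) * f (?e j)) = r * f (?e i)" .
qed

text \<open>Row u of D_\<alpha> sums to \<alpha> Tr(u) + (1 - \<alpha>) Tr(u) = Tr(u), so \<alpha>
  cancels from the all-ones bound.\<close>

lemma rho_D_ge_average_transmission:
  assumes fin: "finite (pverts G)" and ne: "pverts G \<noteq> {}"
    and sym: "\<And>u v. u \<in> pverts G \<Longrightarrow> v \<in> pverts G \<Longrightarrow> gdist G u v = gdist G v u"
  shows "(\<Sum>u\<in>pverts G. transmission G u) / card (pverts G) \<le> rho_D \<alpha> G"
proof -
  let ?e = "from_nat_into (pverts G)" let ?n = "card (pverts G)" let ?A = "gen_distance_mat \<alpha> G"
  have e: "?e i \<in> pverts G" for i using ne by (rule from_nat_into)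
  note A = gen_distance_mat_carrier[of \<alpha> G]
  have "?A\<^sup>T = ?A"
    using A by (intro eq_matI) (auto simp: gen_distance_mat_index sym[OF e e])
  moreover have "0 < ?n" using fin ne by (simp add: card_gt_0_iff)
  ultimately have avg: "entry_sum ?A / ?n \<le> rho_D \<alpha> G"
    unfolding rho_D_def by (rule spectral_radius_ge_average[OF A])
  have "(\<Sum>j<?n. ?A $$ (i, j)) = transmission G (?e i)" if i: "i < ?n" for i
  proof -
    have "(\<Sum>j<?n. ?A $$ (i, j))
        = \<alpha> * transmission G (?e i) + (1 - \<alpha>) * (\<Sum>j<?n. gdist G (?e i) (?e j))"
      using i by (simp add: gen_distance_mat_index sum.distrib sum_distrib_left)
    also have "(\<Sum>j<?n. gdist G (?e i) (?e j)) = transmission G (?e i)"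
      using sum_pverts_enum[OF fin] by (simp add: transmission_def)
    finally show ?thesis by (simp add: algebra_simps)
  qed
  then have "entry_sum ?A = (\<Sum>u\<in>pverts G. transmission G u)"
    using sum_pverts_enum[OF fin, of "transmission G"] A by (simp add: entry_sum_def)
  then show ?thesis using avg by simp
qed

text \<open>The point 2 n - 4 is the average row sum of D_\<alpha> for S_n^+, and 2 n - 3 is the
  largest one; they are the natural enclosure of its radius. The factored value shows the sign at
  the left end.\<close>

lemma star_plus_cubic_lower:
  "star_plus_cubic \<alpha> n (2 * n - 4) = - ((1 - \<alpha>) * (n - 3) * (2 * n - 5))"
  unfolding star_plus_cubic_def by (simp add: algebra_simps power2_eq_square power3_eq_cube)

lemma star_plus_cubic_upper:
  "star_plus_cubic \<alpha> n (2 * n - 3) = (1 - \<alpha>) * (2 * n\<^sup>2 + 4 * n - 10 - (2 * n\<^sup>2 - n) * \<alpha>)"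
  unfolding star_plus_cubic_def by (simp add: algebra_simps power2_eq_square power3_eq_cube)

text \<open>The right-hand side is the characteristic determinant of the reduced 3x3 matrix,
  expanded along the row of the leaves. Here \<open>a\<close> and \<open>b\<close> are the diagonal
  entries of s I - M for the centre and for the triangle vertices, and the other factors are the
  cofactors of the leaf row.\<close>

lemma star_plus_cubic_eq:
  fixes \<alpha> n s :: real
  defines "a \<equiv> s - \<alpha> * (n - 1)" and "b \<equiv> s - \<alpha> * (2 * n - 4) - (1 - \<alpha>)"
  shows "star_plus_cubic \<alpha> n s
    = (s - \<alpha> * (2 * n - 3) - (1 - \<alpha>) * (2 * (n - 4))) * (a * b - 2 * (1 - \<alpha>)\<^sup>2)
      - (1 - \<alpha>) * ((1 - \<alpha>) * (n - 3) * (b + 4 * (1 - \<alpha>))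
        + 4 * ((1 - \<alpha>) * (n - 3) * (2 * a + (1 - \<alpha>))))"
  unfolding star_plus_cubic_def a_def b_def
  by (simp add: algebra_simps power2_eq_square power3_eq_cube)

text \<open>Naming the centre \<open>c\<close> and the extra edge \<open>ab\<close> on an arbitrary
  vertex type lets one computation serve both \<open>G\<close> and \<open>star_plus n\<close>;
  isomorphisms enter only at the end.\<close>

definition is_star_plus :: "'a pair_pre_digraph \<Rightarrow> 'a \<Rightarrow> 'a \<Rightarrow> 'a \<Rightarrow> bool" where
  "is_star_plus G c a b \<longleftrightarrow> c \<in> pverts G \<and> a \<in> pverts G \<and> b \<in> pverts G \<and>
     c \<noteq> a \<and> c \<noteq> b \<and> a \<noteq> b \<and>
     parcs G = {c} \<times> (pverts G - {c}) \<union> (pverts G - {c}) \<times> {c} \<union> {(a, b), (b, a)}"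

definition diameter_two_dist :: "'a pair_pre_digraph \<Rightarrow> 'a \<Rightarrow> 'a \<Rightarrow> real" where
  "diameter_two_dist G u v = (if u = v then 0 else if (u, v) \<in> parcs G then 1 else 2)"

text \<open>Used twice: with all weights 1 it yields the transmissions, with the eigenvector entries
  it yields the distance part of the eigenvalue equation. \<open>L\<close> is the set of the n - 3
  leaves off the triangle.\<close>

lemma star_plus_dist_sum:
  fixes X Y Z :: real
  assumes S: "is_star_plus G c a b" and fin: "finite (pverts G)"
    and d: "\<And>u v. u \<in> pverts G \<Longrightarrow> v \<in> pverts G \<Longrightarrow> gdist G u v = diameter_two_dist G u v"
    and n: "card (pverts G) = n" and u: "u \<in> pverts G"
  shows "(\<Sum>v\<in>pverts G. gdist G u v * (if v = c then Z else if v = a \<or> v = b then X else Y))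
    = (if u = c then 2 * X + (real n - 3) * Y
       else if u = a \<or> u = b then Z + X + 2 * (real n - 3) * Y
       else Z + 4 * X + 2 * (real n - 4) * Y)"
proof -
  let ?V = "pverts G" define L where "L = ?V - {c, a, b}"
  let ?F = "\<lambda>v. if v = c then Z else if v = a \<or> v = b then X else Y"
  note S' = S[unfolded is_star_plus_def]
  have V: "?V = insert c (insert a (insert b L))" and notin: "c \<notin> L" "a \<notin> L" "b \<notin> L"
    using S' by (auto simp: L_def)
  have cab: "c \<noteq> a" "c \<noteq> b" "a \<noteq> b" "a \<noteq> c" "b \<noteq> c" "b \<noteq> a"
    and mem: "c \<in> ?V" "a \<in> ?V" "b \<in> ?V" using S' by auto
  have finL: "finite L" using fin by (simp add: L_def)
  have "n = card L + 3" using n cab finL notin by (subst (asm) V) auto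
  then have cardL: "real (card L) = real n - 3" by simp
  have arcs: "(x, y) \<in> parcs G \<longleftrightarrow>
      (x = c \<and> y \<in> ?V \<and> y \<noteq> c) \<or> (y = c \<and> x \<in> ?V \<and> x \<noteq> c) \<or> (x = a \<and> y = b) \<or> (x = b \<and> y = a)"
    for x y using S' by auto
  have split: "(\<Sum>v\<in>?V. h v) = h c + h a + h b + (\<Sum>v\<in>L. h v)" for h :: "'a \<Rightarrow> real"
    using cab finL notin by (subst V) (simp add: add.assoc)
  have "(\<Sum>v\<in>?V. gdist G u v * ?F v) = (\<Sum>v\<in>?V. diameter_two_dist G u v * ?F v)"
    using d[OF u] by (intro sum.cong) auto
  also have "\<dots> = diameter_two_dist G u c * Z + diameter_two_dist G u a * X
      + diameter_two_dist G u b * X + (\<Sum>v\<in>L. diameter_two_dist G u v * Y)"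
    using cab notin by (subst split) (auto intro!: sum.cong)
  finally have eq: "(\<Sum>v\<in>?V. gdist G u v * ?F v) = \<dots>" .
  consider "u = c" | "u = a \<or> u = b" | "u \<in> L" using u V by auto
  then show ?thesis
  proof cases
    case 1
    have "(\<Sum>v\<in>L. diameter_two_dist G u v * Y) = (\<Sum>v\<in>L. Y)"
      using 1 notin by (intro sum.cong) (auto simp: diameter_two_dist_def arcs L_def)
    then show ?thesis using 1 cab mem eq by (simp add: diameter_two_dist_def arcs cardL)
  next
    case 2
    have "(\<Sum>v\<in>L. diameter_two_dist G u v * Y) = (\<Sum>v\<in>L. 2 * Y)"
      using 2 notin S' by (intro sum.cong) (auto simp: diameter_two_dist_def arcs)
    then show ?thesis using 2 cab mem eq by (auto simp: diameter_two_dist_def arcs cardL)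
  next
    case 3
    have "(\<Sum>v\<in>L. diameter_two_dist G u v * Y) = (\<Sum>v\<in>L - {u}. diameter_two_dist G u v * Y)"
      using finL 3 by (simp add: sum.remove diameter_two_dist_def)
    also have "\<dots> = (\<Sum>v\<in>L - {u}. 2 * Y)"
      using 3 notin by (intro sum.cong) (auto simp: diameter_two_dist_def arcs)
    also have "\<dots> = (real n - 4) * (2 * Y)"
      using card_Suc_Diff1[OF finL 3] cardL by simp
    finally have "(\<Sum>v\<in>L. diameter_two_dist G u v * Y) = (real n - 4) * (2 * Y)" .
    moreover have "u \<noteq> c" "u \<noteq> a" "u \<noteq> b" "u \<in> ?V" using 3 notin by (auto simp: L_def)
    ultimately show ?thesis using cab mem eq by (auto simp: diameter_two_dist_def arcs)
  qed
qed

text \<open>The candidate eigenvector consists of the cofactors of the leaf row. It satisfies the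
  equations at the centre and at the triangle identically in \<open>s\<close>, and the equation at a
  leaf is the cubic itself. The bound on \<open>s\<close> gives positivity: p >= 2 (1 - \<alpha>)
  and q >= 3 (1 - \<alpha>) make p q exceed 2 (1 - \<alpha>)^2.\<close>

lemma star_plus_root_eq_rho_D:
  assumes S: "is_star_plus G c a b" and fin: "finite (pverts G)"
    and d: "\<And>u v. u \<in> pverts G \<Longrightarrow> v \<in> pverts G \<Longrightarrow> gdist G u v = diameter_two_dist G u v"
    and n: "card (pverts G) = n" "4 \<le> n"
    and \<alpha>: "0 \<le> \<alpha>" "\<alpha> < 1"
    and s: "2 * real n - 4 \<le> s" "star_plus_cubic \<alpha> (real n) s = 0"
  shows "rho_D \<alpha> G = s"
proof -
  let ?n = "real n" let ?\<beta> = "1 - \<alpha>"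
  define p where "p = s - \<alpha> * (?n - 1)"
  define q where "q = s - \<alpha> * (2 * ?n - 4) - ?\<beta>"
  define Y where "Y = p * q - 2 * ?\<beta>\<^sup>2"
  define Z where "Z = ?\<beta> * (?n - 3) * (q + 4 * ?\<beta>)"
  define X where "X = ?\<beta> * (?n - 3) * (2 * p + ?\<beta>)"
  let ?f = "\<lambda>v. if v = c then Z else if v = a \<or> v = b then X else Y"
  have n4: "4 \<le> ?n" using n by simp
  have p: "2 * ?\<beta> \<le> p"
  proof -
    have "p - 2 * ?\<beta> = (s - (2 * ?n - 4)) + ?\<beta> * (2 * ?n - 6) + \<alpha> * (?n - 3)"
      by (simp add: p_def algebra_simps)
    moreover have "0 \<le> ?\<beta> * (2 * ?n - 6)" "0 \<le> \<alpha> * (?n - 3)" using \<alpha> n4 by auto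
    ultimately show ?thesis using s(1) by linarith
  qed
  have q: "3 * ?\<beta> \<le> q"
  proof -
    have "q - 3 * ?\<beta> = (s - (2 * ?n - 4)) + ?\<beta> * (2 * ?n - 8)"
      by (simp add: q_def algebra_simps)
    moreover have "0 \<le> ?\<beta> * (2 * ?n - 8)" using \<alpha> n4 by auto
    ultimately show ?thesis using s(1) by linarith
  qed
  have "6 * ?\<beta>\<^sup>2 = (2 * ?\<beta>) * (3 * ?\<beta>)"
    by (simp add: power2_eq_square algebra_simps)
  also have "\<dots> \<le> p * q" using p q \<alpha> by (intro mult_mono) auto
  finally have "6 * ?\<beta>\<^sup>2 \<le> p * q" .
  moreover have "0 < ?\<beta>\<^sup>2" using \<alpha> by simp
  ultimately have Y: "0 < Y" unfolding Y_def by linarith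
  have Z: "0 < Z" unfolding Z_def using \<alpha> n4 q by (intro mult_pos_pos) auto
  have X: "0 < X" unfolding X_def using \<alpha> n4 p by (intro mult_pos_pos) auto
  have root: "(s - \<alpha> * (2 * ?n - 3) - ?\<beta> * (2 * (?n - 4))) * Y = ?\<beta> * (Z + 4 * X)"
    using s(2) unfolding star_plus_cubic_eq X_def Y_def Z_def p_def q_def by simp
  have sums: "(\<Sum>v\<in>pverts G. gdist G u v * (if v = c then z else if v = a \<or> v = b then x else y))
      = (if u = c then 2 * x + (?n - 3) * y else if u = a \<or> u = b then z + x + 2 * (?n - 3) * y
        else z + 4 * x + 2 * (?n - 4) * y)" if "u \<in> pverts G" for u and x y z :: real
    by (rule star_plus_dist_sum[OF S fin _ n(1) that]) (rule d)
  have tr: "transmission G u = (if u = c then ?n - 1 else if u = a \<or> u = b then 2 * ?n - 4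
      else 2 * ?n - 3)" if "u \<in> pverts G" for u
    using sums[OF that, of 1 1 1] unfolding transmission_def if_cancel mult_1_right by (simp split: if_splits)
  show ?thesis
  proof (rule rho_D_positive_eigenvector[OF fin, where f = ?f])
    show "pverts G \<noteq> {}" using S by (auto simp: is_star_plus_def)
    show "0 \<le> gdist G u v" if "u \<in> pverts G" "v \<in> pverts G" for u v
      using d[OF that] by (simp add: diameter_two_dist_def)
    show "0 < ?f u" for u using X Y Z by simp
    fix u assume u: "u \<in> pverts G"
    have ca: "c \<noteq> a" "c \<noteq> b" using S by (auto simp: is_star_plus_def)
    consider "u = c" | "u \<noteq> c" "u = a \<or> u = b" | "u \<noteq> c" "u \<noteq> a" "u \<noteq> b" by blast
    then show "\<alpha> * transmission G u * ?f u + ?\<beta> * (\<Sum>v\<in>pverts G. gdist G u v * ?f v) = s * ?f u"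
    proof cases
      case 1
      have "p * Z = ?\<beta> * (2 * X + (?n - 3) * Y)"
        by (simp add: X_def Y_def Z_def algebra_simps power2_eq_square)
      then show ?thesis unfolding sums[OF u] tr[OF u] using 1 by (simp add: p_def algebra_simps)
    next
      case 2
      have "q * X = ?\<beta> * (Z + 2 * (?n - 3) * Y)"
        by (simp add: X_def Y_def Z_def algebra_simps power2_eq_square)
      then show ?thesis unfolding sums[OF u] tr[OF u] using 2 ca by (auto simp: q_def algebra_simps)
    next
      case 3
      then show ?thesis unfolding sums[OF u] tr[OF u] using root by (simp add: algebra_simps)
    qed
  qed (use \<alpha> in auto)
qed

lemma star_plus_cubic_root_between:
  assumes \<alpha>: "0 \<le> \<alpha>" "\<alpha> < 1" and n: "3 \<le> n"
    and t: "2 * n - 4 \<le> t" "0 < star_plus_cubic \<alpha> n t"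
  obtains s where "2 * n - 4 \<le> s" "s < t" "star_plus_cubic \<alpha> n s = 0"
proof -
  have "star_plus_cubic \<alpha> n (2 * n - 4) \<le> 0"
    using \<alpha> n by (simp add: star_plus_cubic_lower)
  moreover have "continuous_on {2 * n - 4..t} (star_plus_cubic \<alpha> n)"
    unfolding star_plus_cubic_def by (intro continuous_intros)
  ultimately obtain s where "2 * n - 4 \<le> s" "s \<le> t" "star_plus_cubic \<alpha> n s = 0"
    using IVT'[of "star_plus_cubic \<alpha> n" "2 * n - 4" 0 t] t by auto
  moreover have "s \<noteq> t" using t(2) calculation by auto
  ultimately show ?thesis using that[of s] by simp
qed

text \<open>Replacing \<alpha> by 1 in the second factor leaves 5 n - 10.\<close>

lemma star_plus_cubic_upper_pos:
  assumes "\<alpha> < 1" "3 \<le> n"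
  shows "0 < star_plus_cubic \<alpha> n (2 * n - 3)"
proof -
  have "(2 * n\<^sup>2 - n) * \<alpha> \<le> 2 * n\<^sup>2 - n"
    using mult_left_mono[of \<alpha> 1 "2 * n\<^sup>2 - n"] assms mult_mono[of 1 n 1 n]
    by (simp add: power2_eq_square)
  then show ?thesis unfolding star_plus_cubic_upper using assms by (intro mult_pos_pos) auto
qed

text \<open>From 2 n - 4 upwards there is exactly one root: a sign change provides one, and all
  roots there equal the radius. So a positive value of the cubic at such a \<open>t\<close> is a
  test for the radius being below \<open>t\<close>.\<close>

lemma star_plus_rho_D:
  assumes S: "is_star_plus G c a b" and fin: "finite (pverts G)"
    and d: "\<And>u v. u \<in> pverts G \<Longrightarrow> v \<in> pverts G \<Longrightarrow> gdist G u v = diameter_two_dist G u v"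
    and n: "card (pverts G) = n" "4 \<le> n"
    and \<alpha>: "0 \<le> \<alpha>" "\<alpha> < 1"
  shows "is_largest_root (star_plus_cubic \<alpha> (real n)) (rho_D \<alpha> G)"
    and "2 * real n - 4 \<le> t \<Longrightarrow> 0 < star_plus_cubic \<alpha> (real n) t \<Longrightarrow> rho_D \<alpha> G < t"
proof -
  have root: "rho_D \<alpha> G = s" if "2 * real n - 4 \<le> s" "star_plus_cubic \<alpha> (real n) s = 0" for s
    by (rule star_plus_root_eq_rho_D[OF S fin _ n \<alpha> that]) (rule d)
  show less: "rho_D \<alpha> G < t" if t: "2 * real n - 4 \<le> t" "0 < star_plus_cubic \<alpha> (real n) t" for t
  proof -
    obtain s where "2 * real n - 4 \<le> s" "s < t" "star_plus_cubic \<alpha> (real n) s = 0"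
      using star_plus_cubic_root_between[OF \<alpha> _ t] n by auto
    then show ?thesis using root[of s] by simp
  qed
  obtain s where s: "2 * real n - 4 \<le> s" "star_plus_cubic \<alpha> (real n) s = 0"
    using star_plus_cubic_root_between[OF \<alpha>, of "real n" "2 * real n - 3"]
      star_plus_cubic_upper_pos[OF \<alpha>(2), of "real n"] n by auto
  have rho: "rho_D \<alpha> G = s" using root[OF s] .
  show "is_largest_root (star_plus_cubic \<alpha> (real n)) (rho_D \<alpha> G)"
    unfolding is_largest_root_def
  proof (intro conjI allI impI)
    show "star_plus_cubic \<alpha> (real n) (rho_D \<alpha> G) = 0" using s rho by simp
    fix y assume y: "star_plus_cubic \<alpha> (real n) y = 0"
    show "y \<le> rho_D \<alpha> G"
    proof (cases "2 * real n - 4 \<le> y")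
      case True then show ?thesis using root[OF True y] by simp
    next
      case False then show ?thesis using s rho by simp
    qed
  qed
qed

section \<open>Distances and cycles in connected graphs\<close>

lemma length_rev_path: "length (rev_path p) = length p"
  by (induction p) auto

lemma pcas_nth:
  "pcas u p v \<Longrightarrow> Suc i < length p \<Longrightarrow> fst (p ! Suc i) = snd (p ! i)"
proof (induction p arbitrary: u i)
  case (Cons e es)
  then show ?case by (cases es; cases i) auto
qed simp

lemma pcas_ends:
  "pcas u p v \<Longrightarrow> p \<noteq> [] \<Longrightarrow> fst (hd p) = u \<and> snd (last p) = v"
  by (induction u p v rule: pcas.induct) auto

locale connected_pair_graph = pair_graph +
  assumes conn: "Digraph_Component.connected (with_proj G)"
begin

lemma reachable_all: "u \<in> pverts G \<Longrightarrow> v \<in> pverts G \<Longrightarrow> u \<rightarrow>\<^sup>*\<^bsub>with_proj G\<^esub> v"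
  using symmetric_connected_imp_strongly_connected[OF sym_arcs conn]
  by (auto elim!: strongly_connectedE)

lemma awalk_cost_length: "awalk_cost (\<lambda>_. 1) p = length p"
  by (induction p) auto

lemma shortest_awalk:
  assumes "u \<in> pverts G" "v \<in> pverts G"
  obtains p where "awalk u p v" "gdist G u v = length p"
proof -
  obtain p where "apath u p v" "\<mu> (\<lambda>_. 1) u v = awalk_cost (\<lambda>_. 1) p"
    using min_cost_awalk[OF reachable_all[OF assms], of "\<lambda>_. 1"] by auto
  then show thesis
    using that[of p] by (simp add: gdist_def awalk_cost_length apath_def)
qed

lemma gdist_le_length:
  assumes "awalk u p v"
  shows "gdist G u v \<le> length p"
proof -
  have uv: "u \<in> pverts G" "v \<in> pverts G" using assms by auto
  obtain q where "apath u q v" "\<mu> (\<lambda>_. 1) u v = awalk_cost (\<lambda>_. 1) q"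
    using min_cost_awalk[OF reachable_all[OF uv], of "\<lambda>_. 1"] by auto
  then show ?thesis
    using min_cost_le_walk_cost[OF assms, of "\<lambda>_. 1"] by (simp add: gdist_def awalk_cost_length)
qed

lemma gdist_nonneg: "u \<in> pverts G \<Longrightarrow> v \<in> pverts G \<Longrightarrow> 0 \<le> gdist G u v"
  using shortest_awalk by (metis of_nat_0_le_iff)

lemma gdist_commute:
  assumes "u \<in> pverts G" "v \<in> pverts G"
  shows "gdist G u v = gdist G v u"
proof -
  have "gdist G y x \<le> gdist G x y" if xy: "x \<in> pverts G" "y \<in> pverts G" for x y
  proof -
    obtain p where "awalk x p y" "gdist G x y = length p" using shortest_awalk[OF xy] .
    then show ?thesis using gdist_le_length[of y "rev_path p" x] by (simp add: length_rev_path)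
  qed
  then show ?thesis using assms by (meson order_antisym)
qed

text \<open>Only the distances 0, 1, 2 and "at least 3" are told apart, because counting through
  degrees sees no further than common neighbours.\<close>

lemma gdist_ge:
  assumes "u \<in> pverts G" "v \<in> pverts G"
  shows "u \<noteq> v \<Longrightarrow> 1 \<le> gdist G u v"
    and "u \<noteq> v \<Longrightarrow> (u, v) \<notin> parcs G \<Longrightarrow> 2 \<le> gdist G u v"
    and "u \<noteq> v \<Longrightarrow> (u, v) \<notin> parcs G \<Longrightarrow> \<nexists>w. (u, w) \<in> parcs G \<and> (w, v) \<in> parcs G
      \<Longrightarrow> 3 \<le> gdist G u v"
proof -
  obtain p where p: "awalk u p v" "gdist G u v = length p" using shortest_awalk[OF assms] .
  have len0: "length p = 0 \<Longrightarrow> u = v" using p(1) by (auto simp: awalk_simps)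
  have len1: "length p = 1 \<Longrightarrow> (u, v) \<in> parcs G"
    using p(1) by (auto simp: awalk_simps length_Suc_conv)
  have len2: "length p = 2 \<Longrightarrow> \<exists>w. (u, w) \<in> parcs G \<and> (w, v) \<in> parcs G"
    using p(1) by (auto simp: awalk_simps length_Suc_conv numeral_2_eq_2)
  show "1 \<le> gdist G u v" if "u \<noteq> v"
    using that len0 p(2) by (cases "length p") auto
  show "2 \<le> gdist G u v" if "u \<noteq> v" "(u, v) \<notin> parcs G"
  proof -
    have "length p \<noteq> 0" "length p \<noteq> 1" using that len0 len1 by auto
    then have "2 \<le> length p" by linarith
    then show ?thesis using p(2) by simp
  qed
  show "3 \<le> gdist G u v"
    if "u \<noteq> v" "(u, v) \<notin> parcs G" "\<nexists>w. (u, w) \<in> parcs G \<and> (w, v) \<in> parcs G"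
  proof -
    have "length p \<noteq> 0" "length p \<noteq> 1" "length p \<noteq> 2" using that len0 len1 len2 by auto
    then have "3 \<le> length p" by linarith
    then show ?thesis using p(2) by simp
  qed
qed

lemma gdist_le:
  shows "u \<in> pverts G \<Longrightarrow> gdist G u u \<le> 0"
    and "(u, v) \<in> parcs G \<Longrightarrow> gdist G u v \<le> 1"
    and "(u, w) \<in> parcs G \<Longrightarrow> (w, v) \<in> parcs G \<Longrightarrow> gdist G u v \<le> 2"
proof -
  show "gdist G u u \<le> 0" if "u \<in> pverts G"
    using gdist_le_length[of u "[]" u] that by (simp add: awalk_simps)
  show "gdist G u v \<le> 1" if "(u, v) \<in> parcs G"
    using gdist_le_length[of u "[(u, v)]" v] that by (auto simp: awalk_simps dest: in_arcsD2)
  show "gdist G u v \<le> 2" if "(u, w) \<in> parcs G" "(w, v) \<in> parcs G"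
    using gdist_le_length[of u "[(u, w), (w, v)]" v] that
    by (auto simp: awalk_simps dest: in_arcsD2)
qed

section \<open>Spanning trees, fundamental cycles and the number of edges\<close>

lemma neighbour_towards:
  assumes "v \<in> pverts G" "r \<in> pverts G" "v \<noteq> r"
  obtains w where "(v, w) \<in> parcs G" "gdist G w r < gdist G v r"
proof -
  obtain p where p: "awalk v p r" "gdist G v r = length p" using shortest_awalk[OF assms(1,2)] .
  then obtain e q where "p = e # q" using assms(3) by (cases p) (auto simp: awalk_simps)
  then have "e \<in> parcs G" "fst e = v" "awalk (snd e) q r" using p(1) by (auto simp: awalk_simps)
  then show thesis using that[of "snd e"] gdist_le_length[of "snd e" q r] p(2) \<open>p = e # q\<close>
    by (cases e) auto
qed

text \<open>The arcs from every vertex to a neighbour nearer to a root form a spanning tree.\<close>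

lemma spanning_tree:
  assumes r: "r \<in> pverts G"
  obtains T where "T \<subseteq> parcs G" "sym T" "card T \<le> 2 * (card (pverts G) - 1)"
    "\<And>u v. u \<in> pverts G \<Longrightarrow> v \<in> pverts G \<Longrightarrow> (u, v) \<in> T\<^sup>*"
proof -
  let ?V = "pverts G"
  have "\<forall>v\<in>?V - {r}. \<exists>w. (v, w) \<in> parcs G \<and> gdist G w r < gdist G v r"
    using neighbour_towards[OF _ r] by blast
  then obtain par where par: "\<And>v. v \<in> ?V - {r} \<Longrightarrow>
      (v, par v) \<in> parcs G \<and> gdist G (par v) r < gdist G v r"
    by metis
  define T where "T = (\<lambda>v. (v, par v)) ` (?V - {r}) \<union> (\<lambda>v. (par v, v)) ` (?V - {r})"
  have "card T \<le> card (?V - {r}) + card (?V - {r})"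
    unfolding T_def using pair_finite_verts
    by (intro order_trans[OF card_Un_le] add_mono card_image_le) auto
  then have card: "card T \<le> 2 * (card ?V - 1)"
    using r pair_finite_verts by simp
  have symT: "sym T" by (auto simp: T_def sym_def)
  have root: "(v, r) \<in> T\<^sup>*" if v: "v \<in> ?V" for v
  proof -
    \<comment> \<open>Distances are reals, so the induction runs on a natural bound. A strict
      decrease lowers that bound by a whole unit because distances are lengths of walks.\<close>
    obtain k :: nat where "gdist G v r \<le> k" using real_arch_simple by blast
    then show ?thesis using v
    proof (induction k arbitrary: v)
      case 0
      then have "v = r" using gdist_ge(1)[OF \<open>v \<in> ?V\<close> r] by fastforce
      then show ?case by simp
    next
      case (Suc k)
      show ?case
      proof (cases "v = r")
        case False
        let ?w = "par v"
        have w: "(v, ?w) \<in> parcs G" "gdist G ?w r < gdist G v r" "(v, ?w) \<in> T"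
          using par[of v] Suc.prems False by (auto simp: T_def)
        have wV: "?w \<in> ?V" using w(1) by (rule in_arcsD2)
        obtain i j :: nat where "gdist G ?w r = i" "gdist G v r = j"
          using shortest_awalk[OF wV r] shortest_awalk[OF \<open>v \<in> ?V\<close> r] by metis
        then have "gdist G ?w r \<le> k" using w(2) Suc.prems by simp
        then show ?thesis using Suc.IH[OF _ wV] w(3) by (meson converse_rtrancl_into_rtrancl)
      qed simp
    qed
  qed
  show thesis
  proof (rule that[OF _ symT card])
    show "T \<subseteq> parcs G" using par arcs_symmetric by (auto simp: T_def)
    fix u v assume "u \<in> ?V" "v \<in> ?V"
    then show "(u, v) \<in> T\<^sup>*"
      using rtrancl_trans[OF root symD[OF sym_rtrancl[OF symT] root]] by blast
  qed
qed

text \<open>The arc (u, v) closes a \<open>T\<close>-path from v back to u. That path has at least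
  two arcs, since a single one would be (v, u), which symmetry keeps out of \<open>T\<close>; so the
  closed walk is not the degenerate u, v, u.\<close>

lemma fundamental_cycle:
  assumes T: "T \<subseteq> parcs G" and symT: "sym T" and uv: "(u, v) \<in> parcs G - T" and path: "(v, u) \<in> T\<^sup>*"
  obtains C where "C \<in> undirected_cycles G" "{u, v} \<in> C"
    "C \<subseteq> insert {u, v} ((\<lambda>(x, y). {x, y}) ` T)"
proof -
  let ?H = "\<lparr>pverts = pverts G, parcs = T\<rparr>"
  interpret H: pair_wf_digraph ?H
    by unfold_locales (auto dest!: subsetD[OF T] dest: in_arcsD1 in_arcsD2)
  have vu: "v \<in> pverts G" "u \<in> pverts G" "u \<noteq> v"
    using uv by (auto dest: in_arcsD1 in_arcsD2 no_loops')
  have "\<exists>p. H.awalk v p u" using path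
  proof (induction rule: converse_rtrancl_induct)
    case base then show ?case using vu by (auto intro!: exI[of _ "[]"] simp: H.awalk_simps)
  next
    case (step y z)
    then obtain p where "H.awalk z p u" by blast
    then have "H.awalk y ((y, z) # p) u" using step by (simp add: H.awalk_simps)
    then show ?case by blast
  qed
  then obtain p where p: "H.apath v p u"
    using H.reachable_awalk H.reachable_apath by metis
  then have walk: "H.awalk v p u" and dist: "distinct (pawalk_verts v p)"
    by (auto simp: H.apath_def)
  have "set p \<subseteq> T" "pcas v p u" using walk by (auto simp: H.awalk_def)
  then have walkG: "awalk v p u" using T vu by (auto simp: awalk_def)
  have vuT: "(v, u) \<notin> T" using uv symT by (auto dest: symD)
  have "length p \<noteq> 0" "length p \<noteq> 1"
    using walk vu vuT by (auto simp: H.awalk_simps length_Suc_conv)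
  then have "2 \<le> length p" by linarith
  then have len: "3 \<le> length ((u, v) # p)" by simp
  have cyc: "cycle ((u, v) # p)"
    unfolding cycle_def using walkG dist uv by (auto simp: awalk_simps)
  show thesis
  proof (rule that[of "(\<lambda>(x, y). {x, y}) ` set ((u, v) # p)"])
    show "(\<lambda>(x, y). {x, y}) ` set ((u, v) # p) \<in> undirected_cycles G"
      unfolding undirected_cycles_def using cyc len by blast
  qed (use \<open>set p \<subseteq> T\<close> in auto)
qed

text \<open>A fundamental cycle contains its own edge and otherwise only tree edges, so two edges
  outside the tree would give two cycles. At most one edge, that is two arcs, is added to the 2 (n -
  1) arcs of the tree.\<close>

lemma card_parcs_le:
  assumes uniq: "\<exists>!C. C \<in> undirected_cycles G" and ne: "pverts G \<noteq> {}"
  shows "card (parcs G) \<le> 2 * card (pverts G)"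
proof -
  obtain r where r: "r \<in> pverts G" using ne by blast
  obtain T where T: "T \<subseteq> parcs G" "sym T" "card T \<le> 2 * (card (pverts G) - 1)"
    "\<And>u v. u \<in> pverts G \<Longrightarrow> v \<in> pverts G \<Longrightarrow> (u, v) \<in> T\<^sup>*"
    using spanning_tree[OF r] by metis
  have same: "{u, v} = {x, y}" if uv: "(u, v) \<in> parcs G - T" and xy: "(x, y) \<in> parcs G - T" for u v x y
  proof -
    obtain C where C: "C \<in> undirected_cycles G" "{u, v} \<in> C"
      using fundamental_cycle[OF T(1,2) uv] T(4) uv by (metis DiffD1 in_arcsD1 in_arcsD2)
    obtain D where D: "D \<in> undirected_cycles G" "D \<subseteq> insert {x, y} ((\<lambda>(x, y). {x, y}) ` T)"
      using fundamental_cycle[OF T(1,2) xy] T(4) xy by (metis DiffD1 in_arcsD1 in_arcsD2)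
    have "C = D" using uniq C(1) D(1) by blast
    then have "{u, v} \<in> insert {x, y} ((\<lambda>(x, y). {x, y}) ` T)" using C(2) D(2) by blast
    moreover have "{u, v} \<notin> (\<lambda>(x, y). {x, y}) ` T"
      using uv T(2) by (auto simp: doubleton_eq_iff dest: symD)
    ultimately show ?thesis by blast
  qed
  have "card (parcs G - T) \<le> 2"
  proof (cases "parcs G - T = {}")
    case False
    then obtain u v where "(u, v) \<in> parcs G - T" by auto
    then have "parcs G - T \<subseteq> {(u, v), (v, u)}"
      using same[of u v] by (auto simp: doubleton_eq_iff)
    then have "parcs G - T \<subseteq> set [(u, v), (v, u)]" by simp
    then have "card (parcs G - T) \<le> card (set [(u, v), (v, u)])" by (rule card_mono[rotated]) blast
    also have "\<dots> \<le> length [(u, v), (v, u)]" by (rule card_length)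
    finally show ?thesis by simp
  next
    case True
    show ?thesis unfolding True by simp
  qed
  moreover have "card (parcs G) = card T + card (parcs G - T)"
    using card_Diff_subset[OF finite_subset[OF T(1) pair_finite_arcs] T(1)]
      card_mono[OF pair_finite_arcs T(1)] by linarith
  moreover have "0 < card (pverts G)" using ne pair_finite_verts by (simp add: card_gt_0_iff)
  ultimately show ?thesis using T(3) by simp
qed

text \<open>The vertices are taken as the heads of the arcs, which lists the repeated start of the
  closed walk only once. The step from \<open>vs ! i\<close> to the next vertex is then arc number i
  + 1, and the closing step is \<open>p ! 0\<close>.\<close>

lemma cycle_vertices:
  assumes "C \<in> undirected_cycles G"
  obtains vs where "distinct vs" "3 \<le> length vs" "set vs \<subseteq> pverts G"
    "\<And>i. i < length vs \<Longrightarrow> (vs ! i, vs ! (Suc i mod length vs)) \<in> parcs G"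
proof -
  obtain p u where p: "awalk u p u" "distinct (tl (pawalk_verts u p))" "3 \<le> length p"
    using assms by (auto simp: undirected_cycles_def cycle_def)
  have cas: "pcas u p u" and arcs: "set p \<subseteq> parcs G" using p(1) by (auto simp: awalk_def)
  have ne: "p \<noteq> []" using p(3) by auto
  let ?vs = "map snd p"
  have "tl (pawalk_verts u p) = ?vs"
    using awalk_verts_conv'[of u p u] cas ne by simp
  then have "distinct ?vs" using p(2) by simp
  moreover have "set ?vs \<subseteq> pverts G" by (auto dest!: subsetD[OF arcs] dest: in_arcsD2)
  moreover have "(?vs ! i, ?vs ! (Suc i mod length ?vs)) \<in> parcs G" if i: "i < length ?vs" for i
  proof (cases "Suc i < length p")
    case True
    then have "(?vs ! i, ?vs ! (Suc i mod length ?vs)) = p ! Suc i"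
      using pcas_nth[OF cas True] by (simp add: prod_eq_iff)
    then show ?thesis using arcs True nth_mem by fastforce
  next
    case False
    then have i': "Suc i = length p" using i by simp
    then have "p ! i = last p" using ne by (metis diff_Suc_1 last_conv_nth)
    then have "(?vs ! i, ?vs ! (Suc i mod length ?vs)) = p ! 0"
      using i' ne pcas_ends[OF cas ne] by (simp add: prod_eq_iff hd_conv_nth)
    then show ?thesis using arcs ne nth_mem by fastforce
  qed
  ultimately show thesis using that[of ?vs] p(3) by simp
qed

end

section \<open>Second smallest Wiener index\<close>

lemma sum_squares_le_square_sum:
  fixes f :: "'a \<Rightarrow> int"
  assumes "finite V" "\<And>v. v \<in> V \<Longrightarrow> 0 \<le> f v"
  shows "(\<Sum>v\<in>V. (f v)\<^sup>2) \<le> (\<Sum>v\<in>V. f v)\<^sup>2"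
proof -
  have "(\<Sum>v\<in>V. (f v)\<^sup>2) \<le> (\<Sum>v\<in>V. f v * (\<Sum>w\<in>V. f w))"
    using assms by (intro sum_mono) (auto simp: power2_eq_square intro!: mult_left_mono member_le_sum)
  then show ?thesis by (simp add: sum_distrib_right power2_eq_square)
qed

text \<open>With F the total, F^2 minus the sum of squares is the sum of f v (F - f v). If no entry
  carries all of F, each nonzero entry contributes at least F - 1, and there are at least two of
  them unless all entries vanish.\<close>

lemma sum_squares_le_square_sum_spread:
  fixes f :: "'a \<Rightarrow> int"
  assumes fin: "finite V" and f0: "\<And>v. v \<in> V \<Longrightarrow> 0 \<le> f v"
    and lt: "\<And>v. v \<in> V \<Longrightarrow> f v < (\<Sum>v\<in>V. f v)"
  shows "(\<Sum>v\<in>V. (f v)\<^sup>2) \<le> ((\<Sum>v\<in>V. f v) - 1)\<^sup>2 + 1"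
proof (cases "\<exists>v\<in>V. 1 \<le> f v")
  case False
  then have "(\<Sum>v\<in>V. (f v)\<^sup>2) = 0" using f0 by (intro sum.neutral) force
  then show ?thesis by simp
next
  case True
  let ?F = "\<Sum>v\<in>V. f v"
  obtain x where x: "x \<in> V" "1 \<le> f x" using True by blast
  have "\<exists>y\<in>V - {x}. 1 \<le> f y"
  proof (rule ccontr)
    assume "\<not> ?thesis"
    then have "(\<Sum>v\<in>V - {x}. f v) = 0" using f0 by (intro sum.neutral) force
    then show False using lt[OF x(1)] sum.remove[OF fin x(1), of f] by simp
  qed
  then obtain y where y: "y \<in> V" "y \<noteq> x" "1 \<le> f y" by blast
  have prod_nonneg: "0 \<le> f v * (?F - f v)" if "v \<in> V" for v
    using f0[OF that] lt[OF that] by simp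
  have big: "?F - 1 \<le> f v * (?F - f v)" if "v \<in> V" "1 \<le> f v" for v
  proof -
    have "0 \<le> (f v - 1) * (?F - f v - 1)" using that lt[OF that(1)] by (intro mult_nonneg_nonneg) auto
    then show ?thesis by (simp add: algebra_simps)
  qed
  have "2 * (?F - 1) \<le> (\<Sum>v\<in>{x, y}. f v * (?F - f v))"
    using big[OF x] big[of y] y by simp
  also have "\<dots> \<le> (\<Sum>v\<in>V. f v * (?F - f v))"
    using x y prod_nonneg by (intro sum_mono2[OF fin]) auto
  also have "\<dots> = ?F * ?F - (\<Sum>v\<in>V. (f v)\<^sup>2)"
    by (simp add: algebra_simps sum_subtractf sum_distrib_left power2_eq_square)
  finally show ?thesis by (simp add: power2_eq_square algebra_simps)
qed

text \<open>Removing from each vertex of \<open>C\<close> the unit it is forced to have turns the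
  lower bound 1 on \<open>C\<close> into plain nonnegativity of the surplus
  \<open>f\<close>.\<close>

lemma sum_squares_shift:
  fixes e :: "'a \<Rightarrow> int"
  assumes fin: "finite V" and C: "C \<subseteq> V"
  defines "f \<equiv> \<lambda>v. e v - of_bool (v \<in> C)"
  shows "(\<Sum>v\<in>V. e v) = (\<Sum>v\<in>V. f v) + card C"
    and "(\<Sum>v\<in>V. (e v)\<^sup>2) = (\<Sum>v\<in>V. (f v)\<^sup>2) + 2 * (\<Sum>v\<in>C. f v) + card C"
proof -
  have indic: "(\<Sum>v\<in>V. h v * of_bool (v \<in> C)) = (\<Sum>v\<in>C. h v)" for h :: "'a \<Rightarrow> int"
    using sum.inter_restrict[OF fin, of h C] C by (simp add: Int_absorb1 of_bool_def if_distrib cong: if_cong)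
  have "(\<Sum>v\<in>V. e v) = (\<Sum>v\<in>V. f v + 1 * of_bool (v \<in> C))" by (simp add: f_def)
  then show "(\<Sum>v\<in>V. e v) = (\<Sum>v\<in>V. f v) + card C"
    unfolding sum.distrib indic by simp
  have "(\<Sum>v\<in>V. (e v)\<^sup>2) = (\<Sum>v\<in>V. (f v)\<^sup>2 + (2 * f v + 1) * of_bool (v \<in> C))"
    by (intro sum.cong) (auto simp: f_def power2_eq_square algebra_simps)
  then show "(\<Sum>v\<in>V. (e v)\<^sup>2) = (\<Sum>v\<in>V. (f v)\<^sup>2) + 2 * (\<Sum>v\<in>C. f v) + card C"
    unfolding sum.distrib indic by (simp add: sum_distrib_left)
qed

text \<open>By convexity the extreme case puts the whole surplus N - |C| on one vertex of
  \<open>C\<close>: one entry N - |C| + 1 and |C| - 1 entries equal to 1.\<close>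

lemma sum_squares_le_concentrated:
  fixes e :: "'a \<Rightarrow> int" and N :: int
  assumes fin: "finite V" and C: "C \<subseteq> V"
    and e0: "\<And>v. v \<in> V \<Longrightarrow> 0 \<le> e v" and e1: "\<And>v. v \<in> C \<Longrightarrow> 1 \<le> e v"
    and N: "(\<Sum>v\<in>V. e v) \<le> N"
  shows "(\<Sum>v\<in>V. (e v)\<^sup>2) \<le> (N - card C + 1)\<^sup>2 + card C - 1"
proof -
  define f where "f v = e v - of_bool (v \<in> C)" for v
  let ?F = "\<Sum>v\<in>V. f v"
  note shift = sum_squares_shift[OF fin C, of e, folded f_def]
  have f0: "0 \<le> f v" if "v \<in> V" for v using e0[OF that] e1[of v] by (auto simp: f_def)
  have F: "0 \<le> ?F" "?F \<le> N - card C" using f0 shift(1) N by (auto intro: sum_nonneg)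
  have "(\<Sum>v\<in>C. f v) \<le> ?F" using f0 by (intro sum_mono2[OF fin C]) auto
  moreover have "(\<Sum>v\<in>V. (f v)\<^sup>2) \<le> ?F\<^sup>2"
    by (rule sum_squares_le_square_sum[OF fin]) (rule f0)
  ultimately have "(\<Sum>v\<in>V. (e v)\<^sup>2) \<le> ?F\<^sup>2 + 2 * ?F + card C"
    using shift(2) by simp
  also have "\<dots> = (?F + 1)\<^sup>2 + card C - 1" by (simp add: power2_eq_square algebra_simps)
  also have "(?F + 1)\<^sup>2 \<le> (N - card C + 1)\<^sup>2"
    using F by (intro power_mono) auto
  finally show ?thesis by simp
qed

text \<open>The concentrated bound (N - 2)^2 + 2 belongs to S_n^+ when N = n; forbidding the value N
  - 2 on the triangle saves 2 N - 8. Three cases remain: a smaller total, a surplus shared by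
  several vertices (which gives the constant 14), and a surplus carried by one vertex off the
  triangle.\<close>

lemma sum_squares_le_triangle:
  fixes e :: "'a \<Rightarrow> int" and N :: int
  assumes fin: "finite V" and C: "C \<subseteq> V" "card C = 3"
    and e0: "\<And>v. v \<in> V \<Longrightarrow> 0 \<le> e v" and e1: "\<And>v. v \<in> C \<Longrightarrow> 1 \<le> e v"
    and N: "(\<Sum>v\<in>V. e v) \<le> N"
    and not_all: "\<And>v. v \<in> C \<Longrightarrow> e v < N - 2"
  shows "(\<Sum>v\<in>V. (e v)\<^sup>2) \<le> N\<^sup>2 - 6 * N + 14"
proof (cases "(\<Sum>v\<in>V. e v) = N")
  case False
  then have "(\<Sum>v\<in>V. e v) \<le> N - 1" using N by simp
  note sum_squares_le_concentrated[OF fin C(1) e0 e1 this]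
  then show ?thesis using C(2) by (simp add: power2_eq_square algebra_simps)
next
  case True
  define f where "f v = e v - of_bool (v \<in> C)" for v
  let ?F = "\<Sum>v\<in>V. f v"
  note shift = sum_squares_shift[OF fin C(1), of e, folded f_def]
  have f0: "0 \<le> f v" if "v \<in> V" for v using e0[OF that] e1[of v] by (auto simp: f_def)
  have F: "?F = N - 3" using shift(1) True C(2) by simp
  have sq: "(\<Sum>v\<in>V. (e v)\<^sup>2) = (\<Sum>v\<in>V. (f v)\<^sup>2) + 2 * (\<Sum>v\<in>C. f v) + 3"
    using shift(2) C(2) by simp
  show ?thesis
  proof (cases "\<forall>v\<in>V. f v < ?F")
    case True
    have "(\<Sum>v\<in>C. f v) \<le> ?F" using f0 by (intro sum_mono2[OF fin C(1)]) auto
    moreover have "(\<Sum>v\<in>V. (f v)\<^sup>2) \<le> (?F - 1)\<^sup>2 + 1"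
      using True by (intro sum_squares_le_square_sum_spread[OF fin]) (auto intro: f0)
    ultimately show ?thesis unfolding sq F by (simp add: power2_eq_square algebra_simps)
  next
    case False
    then obtain x where x: "x \<in> V" "?F \<le> f x" by force
    have xC: "x \<notin> C" using not_all[of x] x(2) F by (auto simp: f_def)
    have "(\<Sum>v\<in>C. f v) \<le> (\<Sum>v\<in>V - {x}. f v)"
      using f0 xC C(1) fin by (intro sum_mono2) auto
    also have "\<dots> \<le> 0" using sum.remove[OF fin x(1), of f] x(2) by simp
    finally have "(\<Sum>v\<in>C. f v) \<le> 0" .
    moreover have "(\<Sum>v\<in>V. (f v)\<^sup>2) \<le> ?F\<^sup>2"
      by (rule sum_squares_le_square_sum[OF fin]) (rule f0)
    ultimately show ?thesis unfolding sq F
      by (simp add: power2_eq_square algebra_simps)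
  qed
qed

section \<open>Degrees, paths of length two and the Wiener index\<close>

context connected_pair_graph
begin

abbreviation deg :: "'a \<Rightarrow> nat" where "deg v \<equiv> card (parcs G `` {v})"

lemma finite_neighbours: "finite (parcs G `` {v})"
  by (rule finite_subset[OF _ pair_finite_verts]) (auto dest: in_arcsD2)

lemma sum_degree: "(\<Sum>v\<in>pverts G. deg v) = card (parcs G)"
proof -
  have "parcs G = Sigma (pverts G) (\<lambda>v. parcs G `` {v})" by (auto dest: in_arcsD1)
  then show ?thesis using card_SigmaI[of "pverts G" "\<lambda>v. parcs G `` {v}"]
    pair_finite_verts finite_neighbours by simp
qed

lemma degree_pos:
  assumes "2 \<le> card (pverts G)" "v \<in> pverts G"
  shows "1 \<le> deg v"
proof -
  obtain r where "r \<in> pverts G" "r \<noteq> v"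
    using assms pair_finite_verts by (metis card_le_Suc0_iff_eq not_less_eq_eq numeral_2_eq_2)
  then obtain w where "(v, w) \<in> parcs G" using neighbour_towards[OF assms(2), of r] by metis
  then have "parcs G `` {v} \<noteq> {}" by auto
  then show ?thesis using finite_neighbours[of v] by (simp add: Suc_le_eq card_gt_0_iff)
qed

text \<open>The triples are ordered, matching the ordered pairs in the sum of transmissions, and the
  two ends may be adjacent; such triangle paths are discounted later.\<close>

definition paths2 :: "('a \<times> 'a \<times> 'a) set" where
  "paths2 = {(u, v, w). (u, v) \<in> parcs G \<and> (v, w) \<in> parcs G \<and> u \<noteq> w}"

lemma card_paths2: "card paths2 = (\<Sum>v\<in>pverts G. deg v * (deg v - 1))"
  and finite_paths2: "finite paths2"
proof -
  let ?N = "\<lambda>v. parcs G `` {v}"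
  let ?S = "Sigma (pverts G) (\<lambda>v. Sigma (?N v) (\<lambda>u. ?N v - {u}))"
  have eq: "paths2 = (\<lambda>(v, u, w). (u, v, w)) ` ?S"
    by (auto simp: paths2_def image_iff dest: in_arcsD1 in_arcsD2 arcs_symmetric)
  have finS: "finite ?S" using pair_finite_verts finite_neighbours by auto
  then show "finite paths2" unfolding eq by (rule finite_imageI)
  have "card paths2 = card ?S" unfolding eq by (rule card_image) (auto simp: inj_on_def)
  also have "\<dots> = (\<Sum>v\<in>pverts G. card (Sigma (?N v) (\<lambda>u. ?N v - {u})))"
    using pair_finite_verts finite_neighbours by (intro card_SigmaI) auto
  also have "\<dots> = (\<Sum>v\<in>pverts G. \<Sum>u\<in>?N v. card (?N v - {u}))"
    using finite_neighbours by (intro sum.cong card_SigmaI) auto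
  also have "\<dots> = (\<Sum>v\<in>pverts G. deg v * (deg v - 1))"
    by (intro sum.cong refl) simp
  finally show "card paths2 = (\<Sum>v\<in>pverts G. deg v * (deg v - 1))" .
qed

text \<open>
  Counting pairs at distance two by their middle vertices; \<open>R\<close> collects paths of length two
  that are redundant in this count.
\<close>

lemma sum_transmission_ge:
  assumes R: "R \<subseteq> paths2"
    and redundant: "\<And>u v w. (u, v, w) \<in> R \<Longrightarrow> (u, w) \<notin> parcs G \<Longrightarrow> \<exists>v'. (u, v', w) \<in> paths2 - R"
  defines "n \<equiv> int (card (pverts G))"
  shows "real_of_int (3 * (n * n - n) - 2 * int (card (parcs G))
      - (\<Sum>v\<in>pverts G. int (deg v) * (int (deg v) - 1)) + card R)
    \<le> (\<Sum>u\<in>pverts G. transmission G u)"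
proof -
  let ?V = "pverts G"
  define D where "D = {(u, w). u \<noteq> w \<and> (u, w) \<notin> parcs G \<and> (\<exists>v. (u, v) \<in> parcs G \<and> (v, w) \<in> parcs G)}"
  have finR: "finite R" using R finite_paths2 by (rule finite_subset)
  have "D \<subseteq> (\<lambda>(u, v, w). (u, w)) ` (paths2 - R)"
  proof
    fix x assume "x \<in> D"
    then obtain u v w where x: "x = (u, w)" and p: "(u, v, w) \<in> paths2" and uw: "(u, w) \<notin> parcs G"
      by (auto simp: D_def paths2_def)
    have "\<exists>v'. (u, v', w) \<in> paths2 - R" using p uw redundant by blast
    then obtain v' where "(u, v', w) \<in> paths2 - R" by blast
    then show "x \<in> (\<lambda>(u, v, w). (u, w)) ` (paths2 - R)" unfolding x by force
  qed
  then have "card D \<le> card (paths2 - R)"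
    using finite_paths2 by (intro surj_card_le) auto
  then have cardD: "int (card D) \<le> int (card paths2) - int (card R)"
    using card_Diff_subset[OF finR R] card_mono[OF finite_paths2 R] by simp
  have "int (card paths2) = (\<Sum>v\<in>?V. int (deg v) * (int (deg v) - 1))"
    unfolding card_paths2 of_nat_sum
  proof (intro sum.cong refl)
    fix v show "int (deg v * (deg v - 1)) = int (deg v) * (int (deg v) - 1)"
      by (cases "deg v") (auto simp: algebra_simps)
  qed
  note cardD = cardD[unfolded this]
  have count: "(\<Sum>x\<in>?V \<times> ?V. of_bool (x \<in> X)) = real (card X)" if "X \<subseteq> ?V \<times> ?V" for X
    using sum.inter_restrict[of "?V \<times> ?V" "\<lambda>_. 1 :: real" X] that pair_finite_verts
    by (simp add: of_bool_def Int_absorb1)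
  have subs: "D \<subseteq> ?V \<times> ?V" "parcs G \<subseteq> ?V \<times> ?V" "Id_on ?V \<subseteq> ?V \<times> ?V"
    by (auto simp: D_def dest: in_arcsD1 in_arcsD2)
  have "card (Id_on ?V) = card ?V"
    using card_image[of "\<lambda>v. (v, v)" ?V] by (simp add: Id_on_def inj_on_def UNION_singleton_eq_range)
  \<comment> \<open>The summand is 0 on the diagonal, 1 on arcs, 2 on the remaining pairs with a
    common neighbour and 3 elsewhere: a pointwise lower bound for the distance.\<close>
  then have "3 * (real (card ?V) * real (card ?V) - real (card ?V)) - 2 * real (card (parcs G)) - real (card D)
      = (\<Sum>x\<in>?V \<times> ?V. 3 - 3 * of_bool (x \<in> Id_on ?V) - 2 * of_bool (x \<in> parcs G) - of_bool (x \<in> D))"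
    unfolding sum_subtractf sum_distrib_left[symmetric] count[OF subs(1)] count[OF subs(2)] count[OF subs(3)]
    by (simp add: algebra_simps card_cartesian_product)
  also have "\<dots> \<le> (\<Sum>x\<in>?V \<times> ?V. gdist G (fst x) (snd x))"
  proof (rule sum_mono, clarify)
    fix u w assume uw: "u \<in> ?V" "w \<in> ?V"
    have loop: "(u, u) \<notin> parcs G" by (auto dest: no_loops')
    consider "u = w" | "u \<noteq> w" "(u, w) \<in> parcs G" | "u \<noteq> w" "(u, w) \<notin> parcs G" "(u, w) \<in> D"
      | "u \<noteq> w" "(u, w) \<notin> parcs G" "(u, w) \<notin> D" by blast
    then show "3 - 3 * of_bool ((u, w) \<in> Id_on ?V) - 2 * of_bool ((u, w) \<in> parcs G) - of_bool ((u, w) \<in> D)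
        \<le> gdist G (fst (u, w)) (snd (u, w))"
    proof cases
      case 1 then show ?thesis using uw gdist_nonneg[OF uw] by (simp add: D_def loop Id_on_def)
    next
      case 2 then show ?thesis using gdist_ge(1)[OF uw] by (auto simp: D_def)
    next
      case 3 then show ?thesis using gdist_ge(2)[OF uw] by auto
    next
      case 4
      then have "\<nexists>v. (u, v) \<in> parcs G \<and> (v, w) \<in> parcs G" by (auto simp: D_def)
      then show ?thesis using 4 gdist_ge(3)[OF uw] by auto
    qed
  qed
  also have "\<dots> = (\<Sum>u\<in>?V. transmission G u)"
    by (simp add: transmission_def sum.cartesian_product case_prod_beta)
  finally have "real_of_int (3 * (n * n - n) - 2 * int (card (parcs G)) - int (card D))
      \<le> (\<Sum>u\<in>?V. transmission G u)" by (simp add: n_def)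
  moreover have "real_of_int (3 * (n * n - n) - 2 * int (card (parcs G))
      - (\<Sum>v\<in>pverts G. int (deg v) * (int (deg v) - 1)) + card R)
    \<le> real_of_int (3 * (n * n - n) - 2 * int (card (parcs G)) - int (card D))"
    unfolding of_int_le_iff using cardD by linarith
  ultimately show ?thesis by linarith
qed

text \<open>Predecessor and successor on the cycle differ because its length is at least 3.\<close>

lemma cycle_degree:
  assumes vs: "distinct vs" "3 \<le> length vs"
    and arcs: "\<And>i. i < length vs \<Longrightarrow> (vs ! i, vs ! (Suc i mod length vs)) \<in> parcs G"
    and v: "v \<in> set vs"
  shows "2 \<le> deg v"
proof -
  let ?g = "length vs"
  obtain i where i: "i < ?g" "v = vs ! i" using v by (auto simp: in_set_conv_nth)
  define j where "j = Suc i mod ?g"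
  define k where "k = (if i = 0 then ?g - 1 else i - 1)"
  have k: "k < ?g" "Suc k mod ?g = i" using i vs(2) by (auto simp: k_def)
  have "j = (if Suc i = ?g then 0 else Suc i)" using i by (auto simp: j_def)
  then have jk: "j < ?g" "j \<noteq> k" using i vs(2) by (auto simp: k_def split: if_splits)
  have "(v, vs ! j) \<in> parcs G" using arcs[OF i(1)] i by (simp add: j_def)
  moreover have "(v, vs ! k) \<in> parcs G" using arcs[OF k(1)] k(2) i by (simp add: arcs_symmetric)
  ultimately have "{vs ! j, vs ! k} \<subseteq> parcs G `` {v}" by auto
  from card_mono[OF finite_neighbours this] show ?thesis
    using jk k(1) vs(1) by (simp add: nth_eq_iff_index_eq)
qed

text \<open>The star at \<open>c\<close> uses 2 (n - 1) arcs and the edge \<open>ab\<close> two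
  more, which exhausts the 2 n available.\<close>

lemma full_degree_star_plus:
  assumes m: "card (parcs G) \<le> 2 * card (pverts G)" and c: "c \<in> pverts G"
    and full: "card (pverts G) - 1 \<le> deg c"
    and ab: "(a, b) \<in> parcs G" "a \<noteq> c" "b \<noteq> c"
  shows "is_star_plus G c a b"
proof -
  let ?V = "pverts G" let ?L = "pverts G - {c}"
  have aV: "a \<in> ?V" "b \<in> ?V" "a \<noteq> b" using ab by (auto dest: in_arcsD1 in_arcsD2 no_loops')
  have "parcs G `` {c} \<subseteq> ?L" by (auto dest: in_arcsD2 no_loops')
  moreover have "card ?L = card ?V - 1" using c by simp
  ultimately have "parcs G `` {c} = ?L"
    using full pair_finite_verts by (intro card_seteq) auto
  then have star: "(c, v) \<in> parcs G" if "v \<in> ?L" for v using that by blast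
  let ?S = "{c} \<times> ?L \<union> ?L \<times> {c}"
  let ?K = "?S \<union> {(a, b), (b, a)}"
  have sub: "?K \<subseteq> parcs G" using star ab arcs_symmetric by auto
  have fin: "finite ?L" using pair_finite_verts by simp
  have "card ?S = card ?L + card ?L"
    using fin by (subst card_Un_disjoint) auto
  moreover have "card ?K = card ?S + 2"
    using fin aV ab by (subst card_Un_disjoint) auto
  moreover have "0 < card ?V" using c pair_finite_verts by (auto simp: card_gt_0_iff)
  ultimately have "card ?K = 2 * card ?V" using \<open>card ?L = card ?V - 1\<close> by simp
  then have "?K = parcs G" using m by (intro card_seteq[OF pair_finite_arcs sub]) simp
  then show ?thesis unfolding is_star_plus_def using c aV ab by blast
qed

text \<open>Large degrees make many pairs at distance two, so the sum of squares of e = deg - 1 has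
  to be bounded above. A short cycle allows a larger sum of squares, but its redundant paths
  compensate: the constants 14 and 12 for lengths 3 and 4 become 8 after subtracting 6 and
  4.\<close>

lemma unicyclic_sum_transmission:
  assumes uniq: "\<exists>!C. C \<in> undirected_cycles G" and n: "6 \<le> card (pverts G)"
    and no_star: "\<nexists>c a b. is_star_plus G c a b"
  shows "2 * (real (card (pverts G)))\<^sup>2 - 2 * real (card (pverts G)) - 8
    \<le> (\<Sum>u\<in>pverts G. transmission G u)"
proof -
  let ?V = "pverts G"
  define n where "n = int (card ?V)"
  have n6: "6 \<le> n" using n by (simp add: n_def)
  have m: "card (parcs G) \<le> 2 * card ?V" using n by (intro card_parcs_le[OF uniq]) auto
  define e where "e v = int (deg v) - 1" for v
  have e0: "0 \<le> e v" if "v \<in> ?V" for v using degree_pos[OF _ that] n by (simp add: e_def)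
  have sum_e: "(\<Sum>v\<in>?V. e v) = int (card (parcs G)) - n"
    by (simp add: e_def sum_subtractf n_def flip: sum_degree)
  then have sum_e_le: "(\<Sum>v\<in>?V. e v) \<le> n" using m by (simp add: n_def)
  \<comment> \<open>The sum of deg (deg - 1) is the sum of e^2 + e, and there are at most 2 n arcs,
    so the claim reduces to \<open>sq\<close> for some admissible set \<open>R\<close> of redundant
    paths.\<close>
  have goal: ?thesis
    if R: "R \<subseteq> paths2"
      "\<And>u v w. (u, v, w) \<in> R \<Longrightarrow> (u, w) \<notin> parcs G \<Longrightarrow> \<exists>v'. (u, v', w) \<in> paths2 - R"
      and sq: "(\<Sum>v\<in>?V. (e v)\<^sup>2) \<le> n\<^sup>2 - 6 * n + 8 + int (card R)" for R
  proof -
    have "(\<Sum>v\<in>?V. int (deg v) * (int (deg v) - 1)) = (\<Sum>v\<in>?V. (e v)\<^sup>2) + (\<Sum>v\<in>?V. e v)"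
      by (simp add: e_def power2_eq_square algebra_simps flip: sum.distrib)
    then have "2 * n\<^sup>2 - 2 * n - 8 \<le> 3 * (n * n - n) - 2 * int (card (parcs G))
        - (\<Sum>v\<in>?V. int (deg v) * (int (deg v) - 1)) + card R"
      using sq sum_e m by (simp add: power2_eq_square n_def)
    then have "real_of_int (2 * n\<^sup>2 - 2 * n - 8) \<le> real_of_int (3 * (n * n - n) - 2 * int (card (parcs G))
        - (\<Sum>v\<in>?V. int (deg v) * (int (deg v) - 1)) + card R)"
      by (rule of_int_le_iff[THEN iffD2])
    also have "\<dots> \<le> (\<Sum>u\<in>?V. transmission G u)"
      using sum_transmission_ge[OF R] unfolding n_def .
    finally show ?thesis by (simp add: n_def)
  qed
  obtain C where C: "C \<in> undirected_cycles G" using uniq by blast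
  obtain vs where vs: "distinct vs" "3 \<le> length vs" "set vs \<subseteq> ?V"
    and arcs: "\<And>i. i < length vs \<Longrightarrow> (vs ! i, vs ! (Suc i mod length vs)) \<in> parcs G"
    using cycle_vertices[OF C] by metis
  have e1: "1 \<le> e v" if "v \<in> set vs" for v
    using cycle_degree[OF vs(1,2) arcs that] by (simp add: e_def)
  note conc = sum_squares_le_concentrated[OF pair_finite_verts _ e0 _ sum_e_le]
  consider "length vs = 3" | "length vs = 4" | "5 \<le> length vs" using vs(2) by linarith
  then show ?thesis
  proof cases
    case 1
    then obtain a b c where abc: "vs = [a, b, c]" by (auto simp: length_Suc_conv numeral_3_eq_3)
    have d: "a \<noteq> b" "a \<noteq> c" "b \<noteq> c" using vs(1) abc by auto
    have "(a, b) \<in> parcs G" "(b, c) \<in> parcs G" "(c, a) \<in> parcs G"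
      using arcs[of 0] arcs[of 1] arcs[of 2] by (auto simp: abc)
    then have E: "(a, b) \<in> parcs G" "(b, c) \<in> parcs G" "(c, a) \<in> parcs G"
      "(b, a) \<in> parcs G" "(c, b) \<in> parcs G" "(a, c) \<in> parcs G" by (auto intro: arcs_symmetric)
    \<comment> \<open>All six paths within the triangle join adjacent vertices, so none of them
      witnesses a pair at distance two.\<close>
    let ?R = "{(a, b, c), (c, b, a), (b, c, a), (a, c, b), (c, a, b), (b, a, c)}"
    \<comment> \<open>A triangle vertex adjacent to all others, together with the opposite edge of
      the triangle, would make \<open>G\<close> a copy of S_n^+.\<close>
    have small: "e v < n - 2" if v: "v \<in> {a, b, c}" for v
    proof (rule ccontr)
      assume "\<not> ?thesis"
      then have full: "card ?V - 1 \<le> deg v" using n by (simp add: e_def n_def)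
      have "\<exists>x y. (x, y) \<in> parcs G \<and> x \<noteq> v \<and> y \<noteq> v" using v E d by auto
      moreover have "v \<in> ?V" using v vs(3) abc by auto
      ultimately show False using full_degree_star_plus[OF m _ full] no_star by blast
    qed
    have "(\<Sum>v\<in>?V. (e v)\<^sup>2) \<le> n\<^sup>2 - 6 * n + 14"
      using vs(3) abc d e1 small
      by (intro sum_squares_le_triangle[of ?V "{a, b, c}"] pair_finite_verts e0 sum_e_le) auto
    moreover have "card ?R = 6" using d by simp
    ultimately show ?thesis using E d by (intro goal[of ?R]) (auto simp: paths2_def)
  next
    case 2
    then obtain a b c d where abcd: "vs = [a, b, c, d]"
      by (auto simp: length_Suc_conv numeral_eq_Suc)
    have ne: "a \<noteq> b" "a \<noteq> c" "a \<noteq> d" "b \<noteq> c" "b \<noteq> d" "c \<noteq> d" using vs(1) abcd by auto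
    have "(a, b) \<in> parcs G" "(b, c) \<in> parcs G" "(c, d) \<in> parcs G" "(d, a) \<in> parcs G"
      using arcs[of 0] arcs[of 1] arcs[of 2] arcs[of 3] by (auto simp: abcd)
    then have E: "(a, b) \<in> parcs G" "(b, c) \<in> parcs G" "(c, d) \<in> parcs G" "(d, a) \<in> parcs G"
      "(b, a) \<in> parcs G" "(c, b) \<in> parcs G" "(d, c) \<in> parcs G" "(a, d) \<in> parcs G"
      by (auto intro: arcs_symmetric)
    \<comment> \<open>Each opposite pair of the 4-cycle has two middle vertices; dropped are those
      through \<open>b\<close> for the pair a, c and those through \<open>a\<close> for the pair b,
      d.\<close>
    define R where "R = {(a, b, c), (c, b, a), (b, a, d), (d, a, b)}"
    have "(\<Sum>v\<in>?V. (e v)\<^sup>2) \<le> (n - card {a, b, c, d} + 1)\<^sup>2 + card {a, b, c, d} - 1"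
      using vs(3) abcd e1 by (intro conc) auto
    moreover have "card {a, b, c, d} = 4" using ne by simp
    ultimately have "(\<Sum>v\<in>?V. (e v)\<^sup>2) \<le> n\<^sup>2 - 6 * n + 12"
      by (simp add: power2_eq_square algebra_simps)
    moreover have "card R = 4" using ne by (simp add: R_def)
    ultimately have sq: "(\<Sum>v\<in>?V. (e v)\<^sup>2) \<le> n\<^sup>2 - 6 * n + 8 + int (card R)" by simp
    have other: "(a, d, c) \<in> paths2 - R" "(c, d, a) \<in> paths2 - R"
      "(b, c, d) \<in> paths2 - R" "(d, c, b) \<in> paths2 - R"
      using E ne by (auto simp: paths2_def R_def)
    show ?thesis
    proof (rule goal[OF _ _ sq])
      show "R \<subseteq> paths2" using E ne by (auto simp: paths2_def R_def)
      fix u v w assume "(u, v, w) \<in> R"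
      then have "(u, w) \<in> {(a, c), (c, a), (b, d), (d, b)}" by (auto simp: R_def)
      then show "\<exists>v'. (u, v', w) \<in> paths2 - R" using other by blast
    qed
  next
    case 3
    \<comment> \<open>Five cycle vertices suffice, whatever the length: (n - 4)^2 + 4 is at most n^2
      - 6 n + 8 exactly when n >= 6.\<close>
    let ?C = "set (take 5 vs)"
    have C: "?C \<subseteq> set vs" by (rule set_take_subset)
    have card: "card ?C = 5" using 3 vs(1) by (simp add: distinct_card)
    have "(\<Sum>v\<in>?V. (e v)\<^sup>2) \<le> (n - card ?C + 1)\<^sup>2 + card ?C - 1"
      using C vs(3) e1 by (intro conc) auto
    also have "\<dots> \<le> n\<^sup>2 - 6 * n + 8"
      using n6 by (simp add: card power2_eq_square algebra_simps)
    finally show ?thesis by (intro goal[of "{}"]) auto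
  qed
qed

end

section \<open>Isomorphism with \<open>S\<^sub>n\<^sup>+\<close>\<close>

lemma (in pair_graph) is_star_plus_connected:
  assumes "is_star_plus G c a b"
  shows "Digraph_Component.connected (with_proj G)"
proof -
  have star: "(c, v) \<in> parcs G" "(v, c) \<in> parcs G" if "v \<in> pverts G" "v \<noteq> c" for v
    using assms that by (auto simp: is_star_plus_def)
  have to: "v \<rightarrow>\<^sup>*\<^bsub>with_proj G\<^esub> c" "c \<rightarrow>\<^sup>*\<^bsub>with_proj G\<^esub> v" if "v \<in> pverts G" for v
    using star[OF that] that by (cases "v = c"; auto intro: reachable_adjI)+
  have "strongly_connected (with_proj G)"
    using to assms by (intro strongly_connectedI) (auto simp: is_star_plus_def intro: reachable_trans)
  then show ?thesis
    unfolding Digraph_Component.connected_def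
    by (auto simp: strongly_connected_def intro!: reachable_mk_symmetricI)
qed

lemma (in connected_pair_graph) is_star_plus_gdist:
  assumes S: "is_star_plus G c a b" and uv: "u \<in> pverts G" "v \<in> pverts G"
  shows "gdist G u v = diameter_two_dist G u v"
proof -
  have star: "(c, v) \<in> parcs G" "(v, c) \<in> parcs G" if "v \<in> pverts G" "v \<noteq> c" for v
    using S that by (auto simp: is_star_plus_def)
  consider "u = v" | "u \<noteq> v" "(u, v) \<in> parcs G" | "u \<noteq> v" "(u, v) \<notin> parcs G" by blast
  then show ?thesis
  proof cases
    case 1 then show ?thesis using gdist_le(1) gdist_nonneg uv by (force simp: diameter_two_dist_def)
  next
    case 2 then show ?thesis using gdist_le(2) gdist_ge(1)[OF uv] by (force simp: diameter_two_dist_def)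
  next
    case 3
    then have "u \<noteq> c" "v \<noteq> c" using star uv by auto
    then have "gdist G u v \<le> 2" using gdist_le(3)[of u c v] star uv by auto
    then show ?thesis using 3 gdist_ge(2)[OF uv] by (simp add: diameter_two_dist_def)
  qed
qed

lemma card_pverts_star_plus: "card (pverts (star_plus n)) = n"
  by (simp add: star_plus_def star_graph_def)

lemma is_star_plus_star_plus:
  assumes "3 \<le> n"
  shows "is_star_plus (star_plus n) 0 1 2"
  using assms by (auto simp: is_star_plus_def star_plus_def star_graph_def)

lemma star_plus_connected_pair_graph:
  assumes "3 \<le> n"
  shows "connected_pair_graph (star_plus n)"
proof -
  have V: "pverts (star_plus n) = {0..<n}" by (simp add: star_plus_def star_graph_def)
  have sub: "parcs (star_plus n) \<subseteq> {0..<n} \<times> {0..<n}"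
    using assms by (auto simp: star_plus_def star_graph_def)
  interpret pair_graph "star_plus n"
  proof
    show "finite (parcs (star_plus n))" using sub by (rule finite_subset) simp
    show "symmetric (with_proj (star_plus n))"
      by (auto simp: symmetric_def sym_def star_plus_def star_graph_def)
    show "fst e \<noteq> snd e" if "e \<in> parcs (star_plus n)" for e
      using that by (auto simp: star_plus_def star_graph_def)
  qed (use sub V in auto)
  show ?thesis
    by unfold_locales (rule is_star_plus_connected[OF is_star_plus_star_plus[OF assms]])
qed

text \<open>An isomorphism carries separate maps for vertices, arcs and ends. Comparing
  \<open>arcs_ends\<close> leaves a vertex injection that preserves and reflects arcs, along which
  the labelled form is pulled back.\<close>

lemma (in pair_graph) is_star_plus_if_iso:
  assumes iso: "digraph_iso (with_proj G) (with_proj H)" and H: "is_star_plus H c' a' b'"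
  obtains c a b where "is_star_plus G c a b"
proof -
  obtain f where f: "pre_digraph.digraph_isomorphism (with_proj G) f"
    "with_proj H = app_iso f (with_proj G)"
    using iso by (auto simp: digraph_iso_def)
  define h where "h = iso_verts f"
  have inj: "inj_on h (pverts G)" using digraph_isomorphism_inj_on_verts[OF f(1)] by (simp add: h_def)
  have V: "pverts H = h ` pverts G"
    using arg_cong[OF f(2), of verts] by (simp add: h_def)
  have E: "parcs H = (\<lambda>(u, v). (h u, h v)) ` parcs G"
    using arg_cong[OF f(2), of arcs_ends] arcs_ends_app_iso_eq[OF f(1)] by (simp add: h_def)
  have arc: "(u, v) \<in> parcs G \<longleftrightarrow> (h u, h v) \<in> parcs H" if "u \<in> pverts G" "v \<in> pverts G" for u v
  proof
    assume "(h u, h v) \<in> parcs H"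
    then obtain x y where xy: "(x, y) \<in> parcs G" "h x = h u" "h y = h v" unfolding E by auto
    then have "x = u" "y = v" using that inj by (auto simp: inj_on_eq_iff dest: in_arcsD1 in_arcsD2)
    then show "(u, v) \<in> parcs G" using xy(1) by simp
  qed (force simp: E)
  note H' = H[unfolded is_star_plus_def]
  obtain c a b where cab: "c \<in> pverts G" "a \<in> pverts G" "b \<in> pverts G" "h c = c'" "h a = a'" "h b = b'"
    using H' unfolding V by auto
  have heq: "h u = h v \<longleftrightarrow> u = v" if "u \<in> pverts G" "v \<in> pverts G" for u v
    using inj that by (simp add: inj_on_eq_iff)
  have arcs: "(u, v) \<in> parcs G \<longleftrightarrow>
      (u, v) \<in> {c} \<times> (pverts G - {c}) \<union> (pverts G - {c}) \<times> {c} \<union> {(a, b), (b, a)}" for u v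
  proof (cases "u \<in> pverts G \<and> v \<in> pverts G")
    case True
    have "(h u, h v) \<in> parcs H \<longleftrightarrow> (h u, h v) \<in>
        {h c} \<times> (pverts H - {h c}) \<union> (pverts H - {h c}) \<times> {h c} \<union> {(h a, h b), (h b, h a)}"
      using H' cab by simp
    also have "\<dots> \<longleftrightarrow> u = c \<and> v \<noteq> c \<or> v = c \<and> u \<noteq> c \<or> u = a \<and> v = b \<or> u = b \<and> v = a"
      using True cab(1-3) V by (simp add: heq) blast
    finally show ?thesis using True arc[of u v] by simp blast
  next
    case False
    then have "(u, v) \<notin> parcs G" using in_arcsD1 in_arcsD2 by blast
    then show ?thesis using False cab(1-3) by blast
  qed
  have ne: "c \<noteq> a" "c \<noteq> b" "a \<noteq> b" using H' cab(4-6) by blast+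
  have "parcs G = {c} \<times> (pverts G - {c}) \<union> (pverts G - {c}) \<times> {c} \<union> {(a, b), (b, a)}"
    unfolding set_eq_iff split_paired_All by (intro allI arcs)
  then have "is_star_plus G c a b"
    unfolding is_star_plus_def by (intro conjI cab(1-3) ne)
  then show thesis by (rule that)
qed

lemma (in pair_graph) is_star_plus_iso:
  assumes G: "is_star_plus G c a b" and H: "is_star_plus H c' a' b'"
    and fin: "finite (pverts H)" and card: "card (pverts G) = card (pverts H)"
  shows "digraph_iso (with_proj G) (with_proj H)"
proof -
  note G' = G[unfolded is_star_plus_def] and H' = H[unfolded is_star_plus_def]
  let ?L = "pverts G - {c, a, b}" and ?M = "pverts H - {c', a', b'}"
  have "card ?L = card ?M"
    using G' H' card pair_finite_verts fin by (simp add: card_Diff_subset)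
  then obtain g where g: "bij_betw g ?L ?M"
    using pair_finite_verts fin finite_same_card_bij[of ?L ?M] by auto
  define h where "h = g(c := c', a := a', b := b')"
  have hc: "h c = c'" "h a = a'" "h b = b'" using G' by (auto simp: h_def)
  have hL: "h v = g v" if "v \<in> ?L" for v using that by (auto simp: h_def)
  have "bij_betw h ?L ?M" using g bij_betw_cong[of ?L h g ?M] hL by blast
  moreover have "bij_betw h {c, a, b} {c', a', b'}"
    using G' H' hc by (auto simp: bij_betw_def)
  ultimately have "bij_betw h (?L \<union> {c, a, b}) (?M \<union> {c', a', b'})"
    by (rule bij_betw_combine) blast
  moreover have "?L \<union> {c, a, b} = pverts G" "?M \<union> {c', a', b'} = pverts H" using G' H' by auto
  ultimately have "bij_betw h (pverts G) (pverts H)" by (simp only:)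
  then have h: "inj_on h (pverts G)" "h ` pverts G = pverts H" by (auto simp: bij_betw_def)
  \<comment> \<open>The end maps are the projections because the arcs of the image are pairs
    again.\<close>
  define f where "f = \<lparr>iso_verts = h, iso_arcs = (\<lambda>(u, v). (h u, h v)), iso_head = snd, iso_tail = fst\<rparr>"
  have "inj_on (\<lambda>(u, v). (h u, h v)) (parcs G)"
    using h(1) by (auto simp: inj_on_def dest: in_arcsD1 in_arcsD2)
  then have "digraph_isomorphism f"
    unfolding digraph_isomorphism_def f_def using h(1) wf_digraph by auto
  have heq: "h v = c' \<longleftrightarrow> v = c" if "v \<in> pverts G" for v
    using h(1) hc(1) G' that by (metis inj_onD)
  have img: "h ` (pverts G - {c}) = pverts H - {c'}"
    using h hc(1) G' by (simp add: inj_on_image_set_diff[of h "pverts G"])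
  have "(\<lambda>(u, v). (h u, h v)) ` parcs G
      = {h c} \<times> h ` (pverts G - {c}) \<union> h ` (pverts G - {c}) \<times> {h c} \<union> {(h a, h b), (h b, h a)}"
    using G' by (simp only:) (auto simp: image_iff)
  also have "\<dots> = parcs H" using H' hc img by simp
  finally have "with_proj H = app_iso f (with_proj G)"
    using h(2) by (intro pre_digraph.equality) (simp_all add: f_def)
  then show ?thesis using \<open>digraph_isomorphism f\<close> by (auto simp: digraph_iso_def)
qed

text \<open>
  For \<open>n \<ge> 8\<close> the row sum bound \<open>2 * n - 3\<close> is small enough; only \<open>n = 6\<close> and \<open>n = 7\<close>
  keep \<open>\<alpha>\<close> away from 1.
\<close>

lemma star_plus_cubic_threshold:
  fixes n :: nat and \<alpha> :: real
  assumes n: "6 \<le> n" and \<alpha>: "0 \<le> \<alpha>" "\<alpha> < 3/4"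
  obtains t where "2 * real n - 4 \<le> t" "t \<le> 2 * real n - 2 - 8 / real n"
    "0 < star_plus_cubic \<alpha> (real n) t"
proof -
  consider "n = 6" | "n = 7" | "8 \<le> n" using n by linarith
  then show thesis
  proof cases
    case 1
    \<comment> \<open>The point 26/3 is 2 n - 2 - 8/n at n = 6, just as 76/7 is at n = 7. Expanding
      around \<alpha> = 3/4 gives positive coefficients only.\<close>
    have "star_plus_cubic \<alpha> 6 (26/3) = 44 * (3/4 - \<alpha>)\<^sup>2 + 221/9 * (3/4 - \<alpha>) + 139/54"
      unfolding star_plus_cubic_def by (simp add: field_simps power2_eq_square power3_eq_cube)
    also have "\<dots> > 0" using \<alpha> by (intro add_pos_pos mult_pos_pos) auto
    finally show thesis using that[of "26/3"] 1 by simp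
  next
    case 2
    have "star_plus_cubic \<alpha> 7 (76/7)
        = 78 * (3/4 - \<alpha>)\<^sup>2 + 2589/49 * (3/4 - \<alpha>) + 21237/2744"
      unfolding star_plus_cubic_def by (simp add: field_simps power2_eq_square power3_eq_cube)
    also have "\<dots> > 0" using \<alpha> by (intro add_pos_pos mult_pos_pos) auto
    finally show thesis using that[of "76/7"] 2 by simp
  next
    case 3
    then have "2 * real n - 3 \<le> 2 * real n - 2 - 8 / real n" by (simp add: field_simps)
    then show thesis
      using that[of "2 * real n - 3"] star_plus_cubic_upper_pos[of \<alpha> "real n"] \<alpha> n by simp
  qed
qed

theorem theorem3p7:
  fixes G :: "'a pair_pre_digraph" and n :: nat
  assumes "unicyclic G" and "card (pverts G) = n" and "n \<ge> 6"
  shows "\<exists>\<alpha>\<^sub>0::real. 1/2 < \<alpha>\<^sub>0 \<and> \<alpha>\<^sub>0 < 1 \<and>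
    (\<forall>\<alpha>. 0 \<le> \<alpha> \<and> \<alpha> < \<alpha>\<^sub>0 \<longrightarrow>
       rho_D \<alpha> G \<ge> rho_D \<alpha> (star_plus n) \<and>
       is_largest_root (star_plus_cubic \<alpha> (real n)) (rho_D \<alpha> (star_plus n)) \<and>
       (rho_D \<alpha> G = rho_D \<alpha> (star_plus n) \<longleftrightarrow>
          digraph_iso (with_proj G) (with_proj (star_plus n))))"
proof (intro exI conjI allI impI)
  let ?S = "star_plus n"
  have uniq: "\<exists>!C. C \<in> undirected_cycles G" and "pair_graph G"
    and conn: "Digraph_Component.connected (with_proj G)"
    using assms(1) by (auto simp: unicyclic_def)
  interpret G: pair_graph G by fact
  interpret G: connected_pair_graph G by unfold_locales (rule conn)
  interpret S: connected_pair_graph ?S using assms(3) by (intro star_plus_connected_pair_graph) simp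
  have starS: "is_star_plus ?S 0 1 2" using assms(3) by (intro is_star_plus_star_plus) simp
  show "1/2 < (3/4 :: real)" "3/4 < (1 :: real)" by simp_all
  fix \<alpha> :: real assume \<alpha>: "0 \<le> \<alpha> \<and> \<alpha> < 3/4"
  have S: "is_largest_root (star_plus_cubic \<alpha> (real n)) (rho_D \<alpha> ?S)"
    by (rule star_plus_rho_D(1)[OF starS S.pair_finite_verts S.is_star_plus_gdist[OF starS]
          card_pverts_star_plus]) (use \<alpha> assms(3) in auto)
  then show "is_largest_root (star_plus_cubic \<alpha> (real n)) (rho_D \<alpha> ?S)" .
  have "rho_D \<alpha> ?S \<le> rho_D \<alpha> G \<and>
      (rho_D \<alpha> G = rho_D \<alpha> ?S \<longleftrightarrow> digraph_iso (with_proj G) (with_proj ?S))"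
  proof (cases "\<exists>c a b. is_star_plus G c a b")
    case True
    then obtain c a b where star: "is_star_plus G c a b" by blast
    \<comment> \<open>Both radii are the largest root of one cubic, so they agree without an appeal
      to invariance of the spectrum under isomorphism.\<close>
    have "is_largest_root (star_plus_cubic \<alpha> (real n)) (rho_D \<alpha> G)"
      by (rule star_plus_rho_D(1)[OF star G.pair_finite_verts G.is_star_plus_gdist[OF star] assms(2)])
        (use \<alpha> assms(3) in auto)
    then have "rho_D \<alpha> G = rho_D \<alpha> ?S"
      using S unfolding is_largest_root_def by (meson order_antisym)
    moreover have "digraph_iso (with_proj G) (with_proj ?S)"
      using G.is_star_plus_iso[OF star starS S.pair_finite_verts] assms(2)
      by (simp add: card_pverts_star_plus)
    ultimately show ?thesis by simp
  next
    case False
    obtain t where t: "2 * real n - 4 \<le> t" "t \<le> 2 * real n - 2 - 8 / real n"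
      "0 < star_plus_cubic \<alpha> (real n) t"
      using star_plus_cubic_threshold[OF assms(3)] \<alpha> by blast
    have "rho_D \<alpha> ?S < t"
      by (rule star_plus_rho_D(2)[OF starS S.pair_finite_verts S.is_star_plus_gdist[OF starS]
            card_pverts_star_plus]) (use \<alpha> assms(3) t in auto)
    also have "t \<le> (2 * (real n)\<^sup>2 - 2 * real n - 8) / real n"
      using t(2) assms(3) by (simp add: field_simps power2_eq_square)
    also have "\<dots> \<le> (\<Sum>u\<in>pverts G. transmission G u) / real n"
      using G.unicyclic_sum_transmission[OF uniq] False assms(2,3) by (intro divide_right_mono) auto
    also have "\<dots> \<le> rho_D \<alpha> G"
    proof -
      have "pverts G \<noteq> {}" using assms(2,3) by auto
      then show ?thesis
        using rho_D_ge_average_transmission[OF G.pair_finite_verts _ G.gdist_commute] assms(2) by simp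
    qed
    finally have "rho_D \<alpha> ?S < rho_D \<alpha> G" .
    moreover have "\<not> digraph_iso (with_proj G) (with_proj ?S)"
      using G.is_star_plus_if_iso[OF _ starS] False by metis
    ultimately show ?thesis by simp
  qed
  then show "rho_D \<alpha> ?S \<le> rho_D \<alpha> G"
    "rho_D \<alpha> G = rho_D \<alpha> ?S \<longleftrightarrow> digraph_iso (with_proj G) (with_proj ?S)" by auto
qed

end
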